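(* Let $p\ge5$ be a prime and let $G$ be a group of order $p^5$ in the isoclinism family $\Phi_9$. Let $\chi\in\mathrm{nl}(G)$ be such that $\chi=\psi^G$ for some $\psi\in\mathrm{Irr}(C_G(G')|G')$. Then $(C_G(G'),\psi)$ is a required pair for constructing an irreducible rational matrix representation of $G$ affording $\Omega(\chi)$; that is, $\psi$ is a linear character of $C_G(G')$ with $\psi^G=\chi$ and $\mathbb{Q}(\psi)=\mathbb{Q}(\chi)$.
   Context: For a finite group $G$: $\mathrm{Irr}(G)$ is the set of irreducible complex characters, $\mathrm{nl}(G)$ the subset of non-linear ones; for $N\trianglelefteq G$, $\mathrm{Irr}(G|N)=\{\chi\in\mathrm{Irr}(G):N\nsubseteq\ker\chi\}$; $\mathbb{Q}(\chi)$ is the field generated over $\mathbb{Q}$ by the values of $\chi$; $\psi^G$ denotes induction. $\Omega(\chi)=m_{\mathbb{Q}}(\chi)\sum_{\sigma\in\mathrm{Gal}(\mathbb{Q}(\chi)/\mathbb{Q})}\chi^\sigma$, with $m_{\mathbb{Q}}(\chi)$ the Schur index. Required pair: for a finite $p$-group $G$ ($p$ odd) and $\chi\in\mathrm{Irr}(G)$, a required pair for $\Omega(\chi)$ is a pair $(H,\psi)$ with $H\le G$, $\psi$ a linear character of $H$, $\psi^G=\chi$ and $\mathbb{Q}(\psi)=\mathbb{Q}(\chi)$. Two groups $G,H$ are isoclinic if there are isomorphisms $G/Z(G)\to H/Z(H)$ and $G'\to H'$ compatible with the commutator maps. $\Phi_9$ (R. James) is the isoclinism family of the order-$p^5$ group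 $\Phi_9(1^5)=\langle\alpha,\alpha_1,\alpha_2,\alpha_3,\alpha_4:[\alpha_i,\alpha]=\alpha_{i+1}\ (i=1,2,3),\ \alpha^p=\alpha_1^p=\alpha_2^p=\alpha_3^p=\alpha_4^p=1\rangle$ (here $p\ge5$), with $[x,y]=x^{-1}y^{-1}xy$ and unlisted commutators of generators trivial. $C_G(G')$ is the centralizer of $G'$ in $G$ (an abelian subgroup of index $p$). *)

theory Defs
  imports
    "HOL-Algebra.Generated_Groups"
    "HOL-Algebra.Generated_Fields"
    "HOL-Computational_Algebra.Primes"
    "Jordan_Normal_Form.VS_Connect"
begin

section \<open>Centre, centralizers, isoclinism\<close>

definition group_center :: "('a, 'b) monoid_scheme \<Rightarrow> 'a set" where
  "group_center G = {z \<in> carrier G. \<forall>x \<in> carrier G. z \<otimes>\<^bsub>G\<^esub> x = x \<otimes>\<^bsub>G\<^esub> z}"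

definition centralizer :: "('a, 'b) monoid_scheme \<Rightarrow> 'a set \<Rightarrow> 'a set" where
  "centralizer G S = {g \<in> carrier G. \<forall>s \<in> S. g \<otimes>\<^bsub>G\<^esub> s = s \<otimes>\<^bsub>G\<^esub> g}"

text \<open>
  The library's \<^const>\<open>derived\<close> is generated by the elements $xyx^{-1}y^{-1}$. These are the
  commutators below of $x^{-1}$ and $y^{-1}$, so both conventions give the same derived subgroup.
\<close>

definition commutator :: "('a, 'b) monoid_scheme \<Rightarrow> 'a \<Rightarrow> 'a \<Rightarrow> 'a" where
  "commutator G x y = inv\<^bsub>G\<^esub> x \<otimes>\<^bsub>G\<^esub> inv\<^bsub>G\<^esub> y \<otimes>\<^bsub>G\<^esub> x \<otimes>\<^bsub>G\<^esub> y"

abbreviation derived_subgroup :: "('a, 'b) monoid_scheme \<Rightarrow> 'a set" where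
  "derived_subgroup G \<equiv> derived G (carrier G)"

definition isoclinic :: "('a, 'b) monoid_scheme \<Rightarrow> ('c, 'd) monoid_scheme \<Rightarrow> bool" where
  "isoclinic G H \<longleftrightarrow>
    (\<exists>\<phi> \<in> iso (G Mod group_center G) (H Mod group_center H).
     \<exists>\<theta> \<in> iso (G\<lparr>carrier := derived_subgroup G\<rparr>) (H\<lparr>carrier := derived_subgroup H\<rparr>).
       \<forall>x \<in> carrier G. \<forall>y \<in> carrier G. \<forall>x' \<in> carrier H. \<forall>y' \<in> carrier H.
         \<phi> (group_center G #>\<^bsub>G\<^esub> x) = group_center H #>\<^bsub>H\<^esub> x' \<longrightarrow>
         \<phi> (group_center G #>\<^bsub>G\<^esub> y) = group_center H #>\<^bsub>H\<^esub> y' \<longrightarrow>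
         \<theta> (commutator G x y) = commutator H x' y')"


section \<open>Groups given by generators and relations\<close>

text \<open>
  A letter \<open>(x, True)\<close> stands for the generator \<open>x\<close> and \<open>(x, False)\<close> for its inverse. The generators
  are all elements of the type \<open>'g\<close>; a pair \<open>(l, r)\<close> of words is the relation \<open>l = r\<close>.
\<close>

type_synonym 'g word = "('g \<times> bool) list"

inductive word_eq :: "('g word \<times> 'g word) set \<Rightarrow> 'g word \<Rightarrow> 'g word \<Rightarrow> bool"
  for R :: "('g word \<times> 'g word) set" where
  refl: "word_eq R w w"
| sym: "word_eq R v w \<Longrightarrow> word_eq R w v"
| trans: "word_eq R u v \<Longrightarrow> word_eq R v w \<Longrightarrow> word_eq R u w"
| cancel: "word_eq R (u @ [(x, b), (x, \<not> b)] @ v) (u @ v)"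
| relation: "(l, r) \<in> R \<Longrightarrow> word_eq R (u @ l @ v) (u @ r @ v)"

definition word_class :: "('g word \<times> 'g word) set \<Rightarrow> 'g word \<Rightarrow> 'g word set" where
  "word_class R w = {v. word_eq R w v}"

definition presented_group :: "('g word \<times> 'g word) set \<Rightarrow> 'g word set monoid" where
  "presented_group R =
    \<lparr>carrier = range (word_class R),
     monoid.mult = (\<lambda>A B. \<Union>a \<in> A. \<Union>b \<in> B. word_class R (a @ b)),
     one = word_class R []\<rparr>"

definition gen_word :: "'g \<Rightarrow> 'g word" where
  "gen_word x = [(x, True)]"

definition inv_word :: "'g word \<Rightarrow> 'g word" where
  "inv_word w = rev (map (\<lambda>(x, b). (x, \<not> b)) w)"

definition comm_word :: "'g \<Rightarrow> 'g \<Rightarrow> 'g word" where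
  "comm_word x y = inv_word (gen_word x) @ inv_word (gen_word y) @ gen_word x @ gen_word y"

definition power_word :: "'g \<Rightarrow> nat \<Rightarrow> 'g word" where
  "power_word x n = replicate n (x, True)"

lemma word_eq_context: "word_eq R v w \<Longrightarrow> word_eq R (a @ v @ b) (a @ w @ b)"
proof (induction rule: word_eq.induct)
  case (refl w)
  show ?case by (rule word_eq.refl)
next
  case (sym v w)
  show ?case by (rule word_eq.sym[OF sym.IH])
next
  case (trans u v w)
  show ?case by (rule word_eq.trans[OF trans.IH])
next
  case (cancel u x c v)
  then show ?case using word_eq.cancel[of R "a @ u" x c "v @ b"] by simp
next
  case (relation l r u v)
  then show ?case using word_eq.relation[of l r R "a @ u" "v @ b"] by simp
qed

lemma word_eq_append:
  assumes "word_eq R v v'" "word_eq R w w'" shows "word_eq R (v @ w) (v' @ w')"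
proof -
  have "word_eq R (v @ w) (v' @ w)" using word_eq_context[OF assms(1), of "[]" w] by simp
  moreover have "word_eq R (v' @ w) (v' @ w')" using word_eq_context[OF assms(2), of v' "[]"] by simp
  ultimately show ?thesis by (rule word_eq.trans)
qed

lemma word_class_eq_iff: "word_class R v = word_class R w \<longleftrightarrow> word_eq R v w"
proof
  assume "word_class R v = word_class R w"
  moreover have "w \<in> word_class R w" by (simp add: word_class_def word_eq.refl)
  ultimately show "word_eq R v w" by (simp add: word_class_def set_eq_iff)
next
  assume vw: "word_eq R v w"
  then have "word_eq R v u \<longleftrightarrow> word_eq R w u" for u
    using word_eq.trans[OF vw, of u] word_eq.trans[OF word_eq.sym[OF vw], of u] by iprover
  then show "word_class R v = word_class R w" by (simp add: word_class_def)
qed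

lemma presented_group_mult:
  "word_class R v \<otimes>\<^bsub>presented_group R\<^esub> word_class R w = word_class R (v @ w)"
proof -
  have "word_class R (a @ b) = word_class R (v @ w)"
    if "a \<in> word_class R v" "b \<in> word_class R w" for a b
    using that word_eq.sym[OF word_eq_append[of R v a w b]]
    unfolding word_class_eq_iff by (simp add: word_class_def)
  then have "(\<Union>a \<in> word_class R v. \<Union>b \<in> word_class R w. word_class R (a @ b)) =
      (\<Union>a \<in> word_class R v. \<Union>b \<in> word_class R w. word_class R (v @ w))"
    by (intro SUP_cong) simp_all
  also have "\<dots> = word_class R (v @ w)"
  proof -
    have "word_class R v \<noteq> {}" "word_class R w \<noteq> {}"
      using word_eq.refl unfolding word_class_def by fast+
    then show ?thesis by simp
  qed
  finally show ?thesis by (simp add: presented_group_def)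
qed

lemma inv_word_left: "word_eq R (inv_word w @ w) []"
proof (induction w)
  case Nil
  then show ?case by (simp add: inv_word_def word_eq.refl)
next
  case (Cons a w)
  obtain x b where a: "a = (x, b)" by force
  have "inv_word (a # w) @ a # w = inv_word w @ [(x, \<not> b), (x, \<not> \<not> b)] @ w"
    by (simp add: inv_word_def a)
  then show ?case
    using word_eq.trans[OF word_eq.cancel[of R "inv_word w" x "\<not> b" w] Cons.IH] by (simp only:)
qed

lemma presented_group_is_group: "group (presented_group R)"
proof (rule groupI)
  fix A assume "A \<in> carrier (presented_group R)"
  then obtain w where "A = word_class R w" by (auto simp: presented_group_def)
  moreover have "word_class R (inv_word w) \<in> carrier (presented_group R)"
    by (simp add: presented_group_def)
  moreover have "word_class R (inv_word w) \<otimes>\<^bsub>presented_group R\<^esub> word_class R w = \<one>\<^bsub>presented_group R\<^esub>"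
    by (simp only: presented_group_mult) (simp add: presented_group_def word_class_eq_iff inv_word_left)
  ultimately show "\<exists>B \<in> carrier (presented_group R). B \<otimes>\<^bsub>presented_group R\<^esub> A = \<one>\<^bsub>presented_group R\<^esub>"
    by blast
next
  have carr: "carrier (presented_group R) = range (word_class R)"
    and one: "\<one>\<^bsub>presented_group R\<^esub> = word_class R []"
    by (simp_all add: presented_group_def)
  fix A B C
  show "\<one>\<^bsub>presented_group R\<^esub> \<in> carrier (presented_group R)" by (simp add: carr one)
  assume "A \<in> carrier (presented_group R)"
  then obtain a where a: "A = word_class R a" by (auto simp: carr)
  then show "\<one>\<^bsub>presented_group R\<^esub> \<otimes>\<^bsub>presented_group R\<^esub> A = A"
    by (simp add: one presented_group_mult)
  assume "B \<in> carrier (presented_group R)"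
  then obtain b where b: "B = word_class R b" by (auto simp: carr)
  show "A \<otimes>\<^bsub>presented_group R\<^esub> B \<in> carrier (presented_group R)"
    by (simp add: a b presented_group_mult carr)
  assume "C \<in> carrier (presented_group R)"
  then obtain c where "C = word_class R c" by (auto simp: carr)
  then show "A \<otimes>\<^bsub>presented_group R\<^esub> B \<otimes>\<^bsub>presented_group R\<^esub> C =
      A \<otimes>\<^bsub>presented_group R\<^esub> (B \<otimes>\<^bsub>presented_group R\<^esub> C)"
    by (simp add: a b presented_group_mult)
qed


section \<open>The isoclinism family $\Phi_9$\<close>

datatype phi9_gen = Alpha | Alpha1 | Alpha2 | Alpha3 | Alpha4

definition phi9_relations :: "nat \<Rightarrow> (phi9_gen word \<times> phi9_gen word) set" where
  "phi9_relations p =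
     {(comm_word Alpha1 Alpha, gen_word Alpha2),
      (comm_word Alpha2 Alpha, gen_word Alpha3),
      (comm_word Alpha3 Alpha, gen_word Alpha4),
      (comm_word Alpha4 Alpha, [])}
   \<union> {(comm_word x y, []) | x y. x \<noteq> Alpha \<and> y \<noteq> Alpha}
   \<union> {(power_word x p, []) | x. True}"

definition phi9_1_5 :: "nat \<Rightarrow> phi9_gen word set monoid" where
  "phi9_1_5 p = presented_group (phi9_relations p)"

definition in_Phi9 :: "nat \<Rightarrow> ('a, 'b) monoid_scheme \<Rightarrow> bool" where
  "in_Phi9 p G \<longleftrightarrow> isoclinic G (phi9_1_5 p)"


section \<open>Complex characters\<close>

definition representation :: "('a, 'b) monoid_scheme \<Rightarrow> nat \<Rightarrow> ('a \<Rightarrow> complex mat) \<Rightarrow> bool" where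
  "representation G n \<rho> \<longleftrightarrow> \<rho> \<in> hom G (units_of (ring_mat TYPE(complex) n ()))"

definition irreducible_representation ::
  "('a, 'b) monoid_scheme \<Rightarrow> nat \<Rightarrow> ('a \<Rightarrow> complex mat) \<Rightarrow> bool" where
  "irreducible_representation G n \<rho> \<longleftrightarrow>
    representation G n \<rho> \<and> 0 < n \<and>
    (\<forall>W. subspace class_ring W (module_vec TYPE(complex) n) \<longrightarrow>
         (\<forall>g \<in> carrier G. \<forall>w \<in> W. \<rho> g *\<^sub>v w \<in> W) \<longrightarrow>
         W = {0\<^sub>v n} \<or> W = carrier_vec n)"

text \<open>Class functions are \<^const>\<open>undefined\<close> off the carrier, so that equality of characters is
  equality of functions.\<close>

definition rep_character ::
  "('a, 'b) monoid_scheme \<Rightarrow> nat \<Rightarrow> ('a \<Rightarrow> complex mat) \<Rightarrow> 'a \<Rightarrow> complex" where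
  "rep_character G n \<rho> = (\<lambda>g \<in> carrier G. \<Sum>i<n. \<rho> g $$ (i, i))"

definition Irr :: "('a, 'b) monoid_scheme \<Rightarrow> ('a \<Rightarrow> complex) set" where
  "Irr G = {rep_character G n \<rho> | n \<rho>. irreducible_representation G n \<rho>}"

definition linear_chars :: "('a, 'b) monoid_scheme \<Rightarrow> ('a \<Rightarrow> complex) set" where
  "linear_chars G = {\<chi> \<in> Irr G. \<chi> \<one>\<^bsub>G\<^esub> = 1}"

definition nonlinear_chars :: "('a, 'b) monoid_scheme \<Rightarrow> ('a \<Rightarrow> complex) set" where
  "nonlinear_chars G = Irr G - linear_chars G"

definition char_kernel :: "('a, 'b) monoid_scheme \<Rightarrow> ('a \<Rightarrow> complex) \<Rightarrow> 'a set" where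
  "char_kernel G \<chi> = {g \<in> carrier G. \<chi> g = \<chi> \<one>\<^bsub>G\<^esub>}"

definition Irr_over :: "('a, 'b) monoid_scheme \<Rightarrow> 'a set \<Rightarrow> ('a \<Rightarrow> complex) set" where
  "Irr_over G N = {\<chi> \<in> Irr G. \<not> N \<subseteq> char_kernel G \<chi>}"

definition induced_char ::
  "('a, 'b) monoid_scheme \<Rightarrow> 'a set \<Rightarrow> ('a \<Rightarrow> complex) \<Rightarrow> 'a \<Rightarrow> complex" where
  "induced_char G H \<psi> = (\<lambda>g \<in> carrier G.
     (\<Sum>x \<in> carrier G. let y = x \<otimes>\<^bsub>G\<^esub> g \<otimes>\<^bsub>G\<^esub> inv\<^bsub>G\<^esub> x in if y \<in> H then \<psi> y else 0)
       / of_nat (card H))"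

definition char_field :: "('a, 'b) monoid_scheme \<Rightarrow> ('a \<Rightarrow> complex) \<Rightarrow> complex set" where
  "char_field G \<chi> = generate_field class_ring (\<rat> \<union> \<chi> ` carrier G)"

definition required_pair ::
  "('a, 'b) monoid_scheme \<Rightarrow> ('a \<Rightarrow> complex) \<Rightarrow> 'a set \<Rightarrow> ('a \<Rightarrow> complex) \<Rightarrow> bool" where
  "required_pair G \<chi> H \<psi> \<longleftrightarrow>
    subgroup H G \<and> \<psi> \<in> linear_chars (G\<lparr>carrier := H\<rparr>) \<and> induced_char G H \<psi> = \<chi> \<and>
    char_field (G\<lparr>carrier := H\<rparr>) \<psi> = char_field G \<chi>"

end

theory Submission
  imports Defs "Jordan_Normal_Form.Spectral_Radius"
begin

text \<open>
  Lift \<open>\<alpha>\<close> and \<open>\<alpha>\<^sub>1\<close> along the isoclinism to \<open>g, g\<^sub>1 \<in> G\<close> and put \<open>g\<^sub>i\<^sub>+\<^sub>1 = [g\<^sub>i, g]\<close>. Then \<open>G\<close> is generated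
  by \<open>Z(G)\<close>, \<open>g\<close> and \<open>g\<^sub>1\<close>, and since \<open>\<alpha>\<^sub>4 \<noteq> 1\<close> the order \<open>p\<^sup>5\<close> forces \<open>Z(G) = \<langle>g\<^sub>4\<rangle> \<subseteq> G'\<close> and makes
  \<open>B = \<langle>Z(G), g\<^sub>1, g\<^sub>2, g\<^sub>3, g\<^sub>4\<rangle>\<close>, which is abelian of index \<open>p\<close>, the centralizer of \<open>G'\<close>. Moreover \<open>G'\<close> has
  exponent \<open>p\<close> and \<open>a\<^sup>p \<in> Z(G)\<close> for \<open>a \<in> B\<close>.

  Let \<open>F\<close> be the field of values of \<open>\<chi>\<close>. If \<open>b \<in> B\<close> and \<open>\<psi>\<close> is constant on the conjugates of \<open>b\<close>, then
  \<open>\<psi>(b) = \<chi>(b) / p \<in> F\<close>. If \<open>\<psi>\<close> is nontrivial on \<open>Z(G)\<close>, this puts the \<open>p\<close>-th roots of unity into \<open>F\<close>,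
  hence also \<open>\<psi>(G')\<close>; the conjugates of \<open>\<psi>\<close> are distinct on \<open>G'\<close>, so orthogonality on \<open>G'\<close> gives
  \<open>\<psi>(a) = |G'|\<^sup>-\<^sup>1 \<Sum>\<^sub>b \<chi>(ab) \<psi>(b)\<^sup>-\<^sup>1 \<in> F\<close>. If \<open>\<psi>\<close> is trivial on \<open>Z(G)\<close>, all its values are \<open>p\<close>-th roots of
  unity, and as \<open>[G', G, G] \<subseteq> Z(G)\<close> there is \<open>b \<in> G'\<close> with \<open>\<psi>(b) \<noteq> 1\<close> on whose conjugates \<open>\<psi>\<close> is
  constant, so again \<open>F\<close> contains these roots.
\<close>

section \<open>The presented group\<close>

lemma word_class_letter_inverse:
  "word_class R [(x, False)] = inv\<^bsub>presented_group R\<^esub> word_class R [(x, True)]"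
proof -
  interpret H: group "presented_group R" by (rule presented_group_is_group)
  have one: "\<one>\<^bsub>presented_group R\<^esub> = word_class R []" by (simp add: presented_group_def)
  have "word_class R [(x, False)] \<otimes>\<^bsub>presented_group R\<^esub> word_class R [(x, True)] = \<one>\<^bsub>presented_group R\<^esub>"
    unfolding presented_group_mult one word_class_eq_iff
    using word_eq.cancel[of R "[]" x False "[]"] by simp
  then show ?thesis
    by (intro H.inv_equality[symmetric]) (simp_all add: presented_group_def)
qed

lemma word_class_comm_word:
  "word_class R (comm_word x y) =
    commutator (presented_group R) (word_class R (gen_word x)) (word_class R (gen_word y))"
  by (simp add: comm_word_def gen_word_def inv_word_def commutator_def
      word_class_letter_inverse[symmetric] presented_group_mult)

lemma word_class_power_word:
  "word_class R (power_word x n) = word_class R (gen_word x) [^]\<^bsub>presented_group R\<^esub> n"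
proof (induction n)
  case 0
  then show ?case by (simp add: power_word_def presented_group_def)
next
  case (Suc n)
  have "power_word x (Suc n) = power_word x n @ gen_word x"
    by (simp add: power_word_def gen_word_def flip: replicate_append_same)
  then show ?case by (simp add: Suc.IH flip: presented_group_mult)
qed

lemma presented_group_relation:
  "(l, r) \<in> R \<Longrightarrow> word_class R l = word_class R r"
  unfolding word_class_eq_iff using word_eq.relation[of l r R "[]" "[]"] by simp

lemma generate_presented_group:
  assumes "\<And>x. word_class R (gen_word x) \<in> generate (presented_group R) S"
    and "S \<subseteq> carrier (presented_group R)"
  shows "generate (presented_group R) S = carrier (presented_group R)"
proof
  interpret H: group "presented_group R" by (rule presented_group_is_group)
  show "generate (presented_group R) S \<subseteq> carrier (presented_group R)"
    by (rule H.generate_incl[OF assms(2)])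
  have "word_class R w \<in> generate (presented_group R) S" for w
  proof (induction w)
    case Nil
    show ?case
      using generate.one[of "presented_group R" S] by (simp add: presented_group_def)
  next
    case (Cons a w)
    obtain x b where a: "a = (x, b)" by force
    have "word_class R [a] \<in> generate (presented_group R) S"
      using assms(1)[of x] H.generate_m_inv_closed[OF assms(2) assms(1)[of x]]
      by (cases b) (simp_all add: a gen_word_def word_class_letter_inverse)
    then have "word_class R [a] \<otimes>\<^bsub>presented_group R\<^esub> word_class R w \<in> generate (presented_group R) S"
      using Cons.IH by (rule generate.eng)
    then show ?case by (simp add: presented_group_mult)
  qed
  then show "carrier (presented_group R) \<subseteq> generate (presented_group R) S"
    by (auto simp: presented_group_def)
qed

text \<open>The group acts on pairs of residues modulo \<open>p\<close>: \<open>\<alpha>\<close> shifts \<open>x\<close>, and \<open>\<alpha>\<^sub>i\<close> adds to \<open>y\<close> the value at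
  \<open>x\<close> of a polynomial of degree \<open>4 - i\<close>, each polynomial being the difference of the previous one.
  Starting from \<open>6 (x choose 3)\<close> keeps the coefficients integral, and \<open>\<alpha>\<^sub>4\<close> then adds \<open>6\<close>, which is
  nonzero modulo \<open>p \<ge> 5\<close>.\<close>

fun phi9_poly :: "phi9_gen \<Rightarrow> int \<Rightarrow> int" where
  "phi9_poly Alpha x = 0"
| "phi9_poly Alpha1 x = x * (x - 1) * (x - 2)"
| "phi9_poly Alpha2 x = 3 * x * (x - 1)"
| "phi9_poly Alpha3 x = 6 * x"
| "phi9_poly Alpha4 x = 6"

definition phi9_shift :: "phi9_gen \<Rightarrow> int" where
  "phi9_shift c = (if c = Alpha then -1 else 0)"

fun phi9_step :: "phi9_gen \<times> bool \<Rightarrow> int \<times> int \<Rightarrow> int \<times> int" where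
  "phi9_step (c, b) (x, y) =
    (if b then (x + phi9_shift c, y + phi9_poly c x) else (x - phi9_shift c, y - phi9_poly c x))"

definition pair_cong :: "nat \<Rightarrow> int \<times> int \<Rightarrow> int \<times> int \<Rightarrow> bool" where
  "pair_cong p s t \<longleftrightarrow> int p dvd fst s - fst t \<and> int p dvd snd s - snd t"

lemma phi9_poly_cong: "(n::int) dvd x - x' \<Longrightarrow> n dvd phi9_poly c x - phi9_poly c x'"
proof (cases c)
  case Alpha1
  assume "n dvd x - x'"
  then have "n dvd (x - x') * (x^2 + x * x' + x'^2 - 3 * x - 3 * x' + 2)" by simp
  also have "\<dots> = phi9_poly c x - phi9_poly c x'"
    using Alpha1 by (simp add: algebra_simps power2_eq_square)
  finally show ?thesis .
next
  case Alpha2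
  assume "n dvd x - x'"
  then have "n dvd (x - x') * (3 * (x + x' - 1))" by simp
  also have "\<dots> = phi9_poly c x - phi9_poly c x'"
    using Alpha2 by (simp add: algebra_simps)
  finally show ?thesis .
next
  case Alpha3
  assume "n dvd x - x'"
  then have "n dvd 6 * (x - x')" by (rule dvd_mult)
  then show ?thesis unfolding Alpha3 phi9_poly.simps right_diff_distrib .
qed auto

lemma phi9_step_cong:
  assumes "pair_cong p s t" shows "pair_cong p (phi9_step l s) (phi9_step l t)"
proof -
  obtain c b x y x' y' where eq: "l = (c, b)" "s = (x, y)" "t = (x', y')"
    by (cases l; cases s; cases t) auto
  have "int p dvd x - x'" "int p dvd y - y'"
    using assms by (simp_all add: pair_cong_def eq)
  moreover note poly = phi9_poly_cong[OF this(1), of c]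
  ultimately have "int p dvd (y - y') + (phi9_poly c x - phi9_poly c x')"
      "int p dvd (y - y') - (phi9_poly c x - phi9_poly c x')"
    by (blast intro: dvd_add dvd_diff)+
  then show ?thesis using \<open>int p dvd x - x'\<close>
    by (simp add: pair_cong_def eq algebra_simps)
qed

lemma phi9_fold_cong:
  "pair_cong p s t \<Longrightarrow> pair_cong p (fold phi9_step w s) (fold phi9_step w t)"
  by (induction w arbitrary: s t) (simp_all add: phi9_step_cong)

lemma phi9_fold_power:
  "fold phi9_step (power_word c n) (x, y) = (x + int n * phi9_shift c, y + int n * phi9_poly c x)"
proof (induction n arbitrary: x y)
  case (Suc n)
  then show ?case
    by (cases c) (simp_all add: power_word_def phi9_shift_def algebra_simps)
qed (simp add: power_word_def)

lemma phi9_fold_relation: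
  assumes "(l, r) \<in> phi9_relations p"
  shows "pair_cong p (fold phi9_step l s) (fold phi9_step r s)"
proof -
  obtain x y where s: "s = (x, y)" by force
  consider (comm) "(l, r) \<in> {(comm_word Alpha1 Alpha, gen_word Alpha2),
      (comm_word Alpha2 Alpha, gen_word Alpha3), (comm_word Alpha3 Alpha, gen_word Alpha4),
      (comm_word Alpha4 Alpha, [])}"
    | (abel) c d where "l = comm_word c d" "r = []" "c \<noteq> Alpha" "d \<noteq> Alpha"
    | (pow) c where "l = power_word c p" "r = []"
    using assms by (auto simp: phi9_relations_def)
  then show ?thesis
  proof cases
    case comm
    then show ?thesis
      by (auto simp: s comm_word_def inv_word_def gen_word_def phi9_shift_def pair_cong_def
          algebra_simps)
  next
    case abel
    then show ?thesis
      by (simp add: s comm_word_def inv_word_def gen_word_def phi9_shift_def pair_cong_def)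
  next
    case pow
    then show ?thesis by (simp add: s phi9_fold_power pair_cong_def)
  qed
qed

lemma phi9_fold_word_eq:
  assumes "word_eq (phi9_relations p) v w"
  shows "pair_cong p (fold phi9_step v s) (fold phi9_step w s)"
  using assms
proof (induction arbitrary: s rule: word_eq.induct)
  case (refl w)
  then show ?case by (simp add: pair_cong_def)
next
  case (sym v w)
  then show ?case by (simp add: pair_cong_def dvd_diff_commute)
next
  case (trans u v w)
  have "int p dvd a - c" if "int p dvd a - b" "int p dvd b - c" for a b c :: int
    using dvd_add[OF that] by simp
  then show ?case using trans.IH[of s] unfolding pair_cong_def by blast
next
  case (cancel u x b v)
  have "fold phi9_step [(x, b), (x, \<not> b)] t = t" for t
    by (cases t; cases x; cases b) (simp_all add: phi9_shift_def)
  then have "fold phi9_step (u @ [(x, b), (x, \<not> b)] @ v) s = fold phi9_step (u @ v) s"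
    by (simp only: fold_append o_apply)
  then show ?case by (simp add: pair_cong_def)
next
  case (relation l r u v)
  then show ?case by (simp add: phi9_fold_cong phi9_fold_relation)
qed

lemma phi9_Alpha4_nontrivial:
  assumes "prime p" "p \<ge> 5"
  shows "word_class (phi9_relations p) (gen_word Alpha4) \<noteq> \<one>\<^bsub>phi9_1_5 p\<^esub>"
proof
  assume "word_class (phi9_relations p) (gen_word Alpha4) = \<one>\<^bsub>phi9_1_5 p\<^esub>"
  then have "word_eq (phi9_relations p) (gen_word Alpha4) []"
    by (simp add: phi9_1_5_def presented_group_def word_class_eq_iff)
  from phi9_fold_word_eq[OF this, of "(0, 0)"] have "int p dvd int (2 * 3)"
    by (simp add: pair_cong_def gen_word_def)
  then have "p dvd 2 * 3" by (simp only: int_dvd_int_iff)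
  with assms have "p dvd 2 \<or> p dvd 3" by (simp only: prime_dvd_mult_iff)
  with assms(2) show False by (auto dest!: dvd_imp_le)
qed

lemma phi9_group_structure:
  fixes p :: nat
  assumes "prime p" "p \<ge> 5"
  defines "H \<equiv> phi9_1_5 p"
  obtains a a1 a2 a3 a4 where "{a, a1, a2, a3, a4} \<subseteq> carrier H" "generate H {a, a1} = carrier H"
    "commutator H a1 a = a2" "commutator H a2 a = a3" "commutator H a3 a = a4"
    "commutator H a4 a = \<one>\<^bsub>H\<^esub>" "a4 \<noteq> \<one>\<^bsub>H\<^esub>"
    "\<And>x y. x \<in> {a1, a2, a3, a4} \<Longrightarrow> y \<in> {a1, a2, a3, a4} \<Longrightarrow> commutator H x y = \<one>\<^bsub>H\<^esub>"
    "\<And>x. x \<in> {a, a1, a2, a3, a4} \<Longrightarrow> x [^]\<^bsub>H\<^esub> p = \<one>\<^bsub>H\<^esub>"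
proof -
  interpret group H unfolding H_def phi9_1_5_def by (rule presented_group_is_group)
  let ?R = "phi9_relations p"
  define c where "c x = word_class ?R (gen_word x)" for x
  have one: "\<one>\<^bsub>H\<^esub> = word_class ?R []" by (simp add: H_def phi9_1_5_def presented_group_def)
  have carr: "c x \<in> carrier H" for x
    by (simp add: c_def H_def phi9_1_5_def presented_group_def)
  have comm: "commutator H (c x) (c y) = word_class ?R r" if "(comm_word x y, r) \<in> ?R" for x y r
    using presented_group_relation[OF that]
    by (simp add: word_class_comm_word c_def H_def phi9_1_5_def)
  have rels: "commutator H (c Alpha1) (c Alpha) = c Alpha2"
     "commutator H (c Alpha2) (c Alpha) = c Alpha3"
     "commutator H (c Alpha3) (c Alpha) = c Alpha4"
     "commutator H (c Alpha4) (c Alpha) = \<one>\<^bsub>H\<^esub>"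
    using comm[of Alpha1 Alpha "gen_word Alpha2"] comm[of Alpha2 Alpha "gen_word Alpha3"]
      comm[of Alpha3 Alpha "gen_word Alpha4"] comm[of Alpha4 Alpha "[]"]
    by (simp_all add: phi9_relations_def c_def one)
  have abel: "commutator H (c x) (c y) = \<one>\<^bsub>H\<^esub>" if "x \<noteq> Alpha" "y \<noteq> Alpha" for x y
    unfolding one using that by (intro comm) (auto simp: phi9_relations_def)
  have pow: "c x [^]\<^bsub>H\<^esub> p = \<one>\<^bsub>H\<^esub>" for x
  proof -
    have "word_class ?R (power_word x p) = word_class ?R []"
      by (intro presented_group_relation) (auto simp: phi9_relations_def)
    then show ?thesis
      unfolding one by (simp add: word_class_power_word c_def H_def phi9_1_5_def)
  qed
  let ?S = "{c Alpha, c Alpha1}"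
  have S: "?S \<subseteq> carrier H" by (simp add: carr)
  have comm_gen: "commutator H x y \<in> generate H ?S"
    if "x \<in> generate H ?S" "y \<in> generate H ?S" for x y
    unfolding commutator_def by (intro generate.eng generate_m_inv_closed[OF S] that)
  have 1: "c Alpha \<in> generate H ?S" "c Alpha1 \<in> generate H ?S" by (auto intro: generate.incl)
  then have 2: "c Alpha2 \<in> generate H ?S" using comm_gen unfolding rels(1)[symmetric] by blast
  then have 3: "c Alpha3 \<in> generate H ?S" using comm_gen 1 unfolding rels(2)[symmetric] by blast
  then have 4: "c Alpha4 \<in> generate H ?S" using comm_gen 1 unfolding rels(3)[symmetric] by blast
  have "c x \<in> generate H ?S" for x using 1 2 3 4 by (cases x) auto
  then have gen: "generate H ?S = carrier H"
    using generate_presented_group[of ?R ?S] S by (simp add: c_def H_def phi9_1_5_def)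
  show ?thesis
    by (rule that[of "c Alpha" "c Alpha1" "c Alpha2" "c Alpha3" "c Alpha4"])
      (use carr gen rels phi9_Alpha4_nontrivial[OF assms(1,2)] abel pow in
        \<open>auto simp: c_def[symmetric] H_def[symmetric]\<close>)
qed

section \<open>Commutators and normal subgroups\<close>

definition center_mod :: "('a, 'b) monoid_scheme \<Rightarrow> 'a set \<Rightarrow> 'a set" where
  "center_mod G N = {x \<in> carrier G. \<forall>y \<in> carrier G. commutator G x y \<in> N}"

lemma center_modD: "x \<in> center_mod G N \<Longrightarrow> y \<in> carrier G \<Longrightarrow> commutator G x y \<in> N"
  by (simp add: center_mod_def)

context group
begin

lemma commutator_closed [simp, intro]:
  "x \<in> carrier G \<Longrightarrow> y \<in> carrier G \<Longrightarrow> commutator G x y \<in> carrier G"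
  by (simp add: commutator_def)

lemma mult_inv_cancel:
  assumes "x \<in> carrier G" "y \<in> carrier G"
  shows "x \<otimes> (inv x \<otimes> y) = y" and "inv x \<otimes> (x \<otimes> y) = y"
  using assms by (simp_all flip: m_assoc)

lemma mult_commutator:
  assumes "x \<in> carrier G" "y \<in> carrier G"
  shows "y \<otimes> x \<otimes> commutator G x y = x \<otimes> y"
  using assms by (simp add: commutator_def m_assoc mult_inv_cancel)

lemma commutator_eq_one_iff:
  assumes "x \<in> carrier G" "y \<in> carrier G"
  shows "commutator G x y = \<one> \<longleftrightarrow> x \<otimes> y = y \<otimes> x"
proof -
  have "commutator G x y = \<one> \<longleftrightarrow> y \<otimes> x \<otimes> commutator G x y = y \<otimes> x"
    using assms l_cancel_one[of "y \<otimes> x" "commutator G x y"] by simp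
  then show ?thesis using assms by (simp add: mult_commutator)
qed

lemma conj_eq_mult_commutator:
  assumes "x \<in> carrier G" "y \<in> carrier G"
  shows "inv y \<otimes> x \<otimes> y = x \<otimes> commutator G x y"
    and "y \<otimes> x \<otimes> inv y = x \<otimes> commutator G x (inv y)"
  using assms by (simp_all add: commutator_def m_assoc mult_inv_cancel)

lemma centralizer_subgroup:
  assumes "S \<subseteq> carrier G" shows "subgroup (centralizer G S) G"
proof
  show "centralizer G S \<subseteq> carrier G" "\<one> \<in> centralizer G S"
    using assms by (auto simp: centralizer_def)
  fix x assume x: "x \<in> centralizer G S"
  then have xs: "x \<in> carrier G" "\<And>s. s \<in> S \<Longrightarrow> x \<otimes> s = s \<otimes> x" by (auto simp: centralizer_def)
  have "inv x \<otimes> s = s \<otimes> inv x" if s: "s \<in> S" for s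
  proof -
    have sG: "s \<in> carrier G" using s assms by blast
    have "inv x \<otimes> s = inv x \<otimes> (s \<otimes> x) \<otimes> inv x" using xs(1) sG by (simp add: m_assoc)
    also have "\<dots> = s \<otimes> inv x"
      using xs(1) sG xs(2)[OF s, symmetric] by (simp add: m_assoc mult_inv_cancel)
    finally show ?thesis .
  qed
  then show "inv x \<in> centralizer G S" using xs by (simp add: centralizer_def)
  fix y assume y: "y \<in> centralizer G S"
  then have ys: "y \<in> carrier G" "\<And>s. s \<in> S \<Longrightarrow> y \<otimes> s = s \<otimes> y" by (auto simp: centralizer_def)
  have "x \<otimes> y \<otimes> s = s \<otimes> (x \<otimes> y)" if s: "s \<in> S" for s
  proof -
    have sG: "s \<in> carrier G" using s assms by blast
    have "x \<otimes> y \<otimes> s = x \<otimes> s \<otimes> y" using xs(1) ys(1) ys(2)[OF s] sG by (simp add: m_assoc)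
    then show ?thesis using xs(1) xs(2)[OF s] ys(1) sG by (simp add: m_assoc)
  qed
  then show "x \<otimes> y \<in> centralizer G S" using xs ys by (simp add: centralizer_def)
qed

lemma group_center_eq_centralizer: "group_center G = centralizer G (carrier G)"
  by (simp add: group_center_def centralizer_def)

lemma group_center_normal: "group_center G \<lhd> G"
proof -
  have "x \<otimes> z \<otimes> inv x = z" if "x \<in> carrier G" "z \<in> group_center G" for x z
    using that inv_solve_right'[of z "x \<otimes> z" x] by (auto simp: group_center_def)
  then show ?thesis
    using centralizer_subgroup[OF subset_refl] by (auto simp: normal_inv_iff group_center_eq_centralizer)
qed

lemma generate_commute:
  assumes "S \<subseteq> carrier G" "T \<subseteq> carrier G"
    and "\<And>s t. s \<in> S \<Longrightarrow> t \<in> T \<Longrightarrow> s \<otimes> t = t \<otimes> s"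
    and "x \<in> generate G S" "y \<in> generate G T"
  shows "x \<otimes> y = y \<otimes> x"
proof -
  have "S \<subseteq> centralizer G T" using assms(1-3) by (auto simp: centralizer_def)
  then have S: "generate G S \<subseteq> centralizer G T"
    using generate_subgroup_incl centralizer_subgroup[OF assms(2)] by blast
  have sub: "generate G S \<subseteq> carrier G" by (rule generate_incl[OF assms(1)])
  have "T \<subseteq> centralizer G (generate G S)" using S assms(2) by (auto simp: centralizer_def)
  then have "generate G T \<subseteq> centralizer G (generate G S)"
    using generate_subgroup_incl centralizer_subgroup[OF sub] by blast
  then show ?thesis using assms(4,5) by (auto simp: centralizer_def)
qed

lemma commutator_in_normal_iff:
  assumes "N \<lhd> G" "x \<in> carrier G" "y \<in> carrier G"
  shows "commutator G x y \<in> N \<longleftrightarrow>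
    (N #> x) \<otimes>\<^bsub>G Mod N\<^esub> (N #> y) = (N #> y) \<otimes>\<^bsub>G Mod N\<^esub> (N #> x)"
proof -
  interpret N: normal N G by (rule assms(1))
  have "commutator G x y \<in> N \<longleftrightarrow> inv (y \<otimes> x) \<otimes> (x \<otimes> y) \<in> N"
    using assms by (simp add: commutator_def inv_mult_group m_assoc)
  also have "\<dots> \<longleftrightarrow> x \<otimes> y \<otimes> inv (y \<otimes> x) \<in> N"
  proof
    assume "inv (y \<otimes> x) \<otimes> (x \<otimes> y) \<in> N"
    from N.inv_op_closed2[OF _ this, of "y \<otimes> x"] assms(2,3)
    show "x \<otimes> y \<otimes> inv (y \<otimes> x) \<in> N" by (simp add: m_assoc[symmetric])
  next
    assume "x \<otimes> y \<otimes> inv (y \<otimes> x) \<in> N"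
    from N.inv_op_closed1[OF _ this, of "y \<otimes> x"] assms(2,3)
    show "inv (y \<otimes> x) \<otimes> (x \<otimes> y) \<in> N" by (simp add: m_assoc)
  qed
  also have "\<dots> \<longleftrightarrow> x \<otimes> y \<in> N #> (y \<otimes> x)"
    using N.rcos_module[OF is_group, of "y \<otimes> x" "x \<otimes> y"] assms by simp
  also have "\<dots> \<longleftrightarrow> N #> (x \<otimes> y) = N #> (y \<otimes> x)"
    using repr_independence[of "x \<otimes> y" N "y \<otimes> x"] rcos_self[of "x \<otimes> y" N] N.subgroup_axioms assms
    by auto
  finally show ?thesis using assms by (simp add: N.rcos_sum)
qed

lemma commutator_generate_in_normal:
  assumes "N \<lhd> G" "S \<subseteq> carrier G" "T \<subseteq> carrier G"
    and "\<And>s t. s \<in> S \<Longrightarrow> t \<in> T \<Longrightarrow> commutator G s t \<in> N"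
    and "x \<in> generate G S" "y \<in> generate G T"
  shows "commutator G x y \<in> N"
proof -
  interpret N: normal N G by (rule assms(1))
  interpret Q: group "G Mod N" by (rule N.factorgroup_is_group)
  interpret h: group_hom G "G Mod N" "\<lambda>a. N #> a"
    by unfold_locales (rule N.r_coset_hom_Mod)
  have *: "N #> x \<in> generate (G Mod N) ((\<lambda>a. N #> a) ` S)"
    "N #> y \<in> generate (G Mod N) ((\<lambda>a. N #> a) ` T)"
    using h.generate_img assms by blast+
  have "(N #> x) \<otimes>\<^bsub>G Mod N\<^esub> (N #> y) = (N #> y) \<otimes>\<^bsub>G Mod N\<^esub> (N #> x)"
  proof (rule Q.generate_commute[OF _ _ _ *])
    show "(\<lambda>a. N #> a) ` S \<subseteq> carrier (G Mod N)" "(\<lambda>a. N #> a) ` T \<subseteq> carrier (G Mod N)"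
      using assms(2,3) by (auto simp: carrier_FactGroup)
    show "s \<otimes>\<^bsub>G Mod N\<^esub> t = t \<otimes>\<^bsub>G Mod N\<^esub> s"
      if "s \<in> (\<lambda>a. N #> a) ` S" "t \<in> (\<lambda>a. N #> a) ` T" for s t
      using that assms commutator_in_normal_iff[OF assms(1)] by blast
  qed
  moreover have "x \<in> carrier G" "y \<in> carrier G"
    using assms generate_incl by blast+
  ultimately show ?thesis using commutator_in_normal_iff[OF assms(1)] by blast
qed

lemma commutator_in_derived:
  assumes "x \<in> carrier G" "y \<in> carrier G"
  shows "commutator G x y \<in> derived_subgroup G"
proof -
  have "commutator G x y = inv x \<otimes> inv y \<otimes> inv (inv x) \<otimes> inv (inv y)"
    using assms by (simp add: commutator_def)
  also have "\<dots> \<in> derived_set G (carrier G)" using assms[THEN inv_closed] by blast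
  finally show ?thesis unfolding derived_def by (rule generate.incl)
qed

lemma derived_subset_normal:
  assumes "N \<lhd> G" "S \<subseteq> carrier G" "generate G S = carrier G"
    and "\<And>s t. s \<in> S \<Longrightarrow> t \<in> S \<Longrightarrow> commutator G s t \<in> N"
  shows "derived_subgroup G \<subseteq> N"
proof -
  have comm: "commutator G x y \<in> N" if "x \<in> carrier G" "y \<in> carrier G" for x y
    using commutator_generate_in_normal[OF assms(1,2,2,4)] that assms(3) by blast
  have "x \<otimes> y \<otimes> inv x \<otimes> inv y \<in> N" if "x \<in> carrier G" "y \<in> carrier G" for x y
    using comm[of "inv x" "inv y"] that by (simp add: commutator_def)
  then have "derived_set G (carrier G) \<subseteq> N" by auto
  then show ?thesis
    unfolding derived_def
    using assms(1) normal_imp_subgroup by (intro generate_subgroup_incl) auto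
qed

lemma center_mod_normal:
  assumes "N \<lhd> G" shows "center_mod G N \<lhd> G" and "N \<subseteq> center_mod G N"
proof -
  interpret N: normal N G by (rule assms(1))
  let ?U = "center_mod G N"
  interpret Q: group "G Mod N" by (rule N.factorgroup_is_group)
  interpret h: group_hom G "G Mod N" "\<lambda>a. N #> a"
    by unfold_locales (rule N.r_coset_hom_Mod)
  interpret C: subgroup "group_center (G Mod N)" "G Mod N"
    unfolding Q.group_center_eq_centralizer by (rule Q.centralizer_subgroup) simp
  have U: "x \<in> ?U \<longleftrightarrow> x \<in> carrier G \<and> N #> x \<in> group_center (G Mod N)" for x
    using commutator_in_normal_iff[OF assms]
    by (auto simp: center_mod_def group_center_def carrier_FactGroup)
  show sub: "N \<subseteq> ?U"
  proof
    fix n assume n: "n \<in> N"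
    have "N #> n = \<one>\<^bsub>G Mod N\<^esub>" using n coset_join2[OF _ N.subgroup_axioms] by simp
    then show "n \<in> ?U" using n C.one_closed by (simp add: U)
  qed
  have subgr: "subgroup ?U G"
  proof
    show "?U \<subseteq> carrier G" by (auto simp: center_mod_def)
    show "\<one> \<in> ?U" using sub N.one_closed by blast
    fix x assume x: "x \<in> ?U"
    then show "inv x \<in> ?U" using C.m_inv_closed h.hom_inv[of x] by (simp add: U)
    fix y assume "y \<in> ?U"
    then show "x \<otimes> y \<in> ?U" using x C.m_closed h.hom_mult[of x y] by (simp add: U)
  qed
  have "x \<otimes> z \<otimes> inv x \<in> ?U" if "x \<in> carrier G" "z \<in> ?U" for x z
  proof -
    have z: "z \<in> carrier G" using that(2) by (simp add: center_mod_def)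
    have "commutator G z (inv x) \<in> ?U"
      using that sub by (auto simp: center_mod_def)
    then show ?thesis
      unfolding conj_eq_mult_commutator(2)[OF z that(1)]
      using subgroup.m_closed[OF subgr that(2)] by blast
  qed
  then show "?U \<lhd> G" using subgr by (simp add: normal_inv_iff)
qed

lemma center_mod_trivial: "center_mod G {\<one>} = group_center G"
  by (auto simp: center_mod_def group_center_def commutator_eq_one_iff)

lemma center_modI:
  assumes "N \<lhd> G" "S \<subseteq> carrier G" "generate G S = carrier G" "x \<in> carrier G"
    and "\<And>s. s \<in> S \<Longrightarrow> commutator G x s \<in> N"
  shows "x \<in> center_mod G N"
proof -
  have "commutator G x y \<in> N" if "y \<in> carrier G" for y
  proof (rule commutator_generate_in_normal[OF assms(1) _ assms(2)])
    show "{x} \<subseteq> carrier G" using assms(4) by simp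
    show "x \<in> generate G {x}" by (simp add: generate.incl)
    show "y \<in> generate G S" using that assms(3) by simp
    show "commutator G s t \<in> N" if "s \<in> {x}" "t \<in> S" for s t using that assms(5) by simp
  qed
  then show ?thesis using assms(4) by (simp add: center_mod_def)
qed

lemma inv_conj_inj: "x \<in> carrier G \<Longrightarrow> inj_on (\<lambda>n. inv x \<otimes> n \<otimes> x) (carrier G)"
proof (rule inj_onI)
  fix n m assume *: "x \<in> carrier G" "n \<in> carrier G" "m \<in> carrier G" "inv x \<otimes> n \<otimes> x = inv x \<otimes> m \<otimes> x"
  then have "inv x \<otimes> n = inv x \<otimes> m" using right_cancel[of x "inv x \<otimes> n" "inv x \<otimes> m"] by simp
  then show "n = m" using * Units_l_cancel[of "inv x" n m] by simp
qed

text \<open>In a finite group, a subgroup mapped into itself by conjugation with \<open>s\<close> is mapped onto itself,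
  so only one direction of conjugation has to be checked.\<close>

lemma normal_if_generators_normalize:
  assumes "finite (carrier G)" "subgroup N G" "S \<subseteq> carrier G" "generate G S = carrier G"
    and "\<And>s n. s \<in> S \<Longrightarrow> n \<in> N \<Longrightarrow> inv s \<otimes> n \<otimes> s \<in> N"
  shows "N \<lhd> G"
proof -
  interpret N: subgroup N G by (rule assms(2))
  have fin: "finite N" using assms(1) N.subset by (rule rev_finite_subset)
  have S: "s \<otimes> n \<otimes> inv s \<in> N" if "s \<in> S" "n \<in> N" for s n
  proof -
    have s: "s \<in> carrier G" using that assms(3) by blast
    have "inj_on (\<lambda>n. inv s \<otimes> n \<otimes> s) N"
      using inv_conj_inj[OF s] N.subset by (rule inj_on_subset)
    moreover have "(\<lambda>n. inv s \<otimes> n \<otimes> s) ` N \<subseteq> N" using assms(5) that by blast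
    ultimately have "(\<lambda>n. inv s \<otimes> n \<otimes> s) ` N = N" using endo_inj_surj fin by blast
    then obtain m where m: "m \<in> N" "n = inv s \<otimes> m \<otimes> s" using \<open>n \<in> N\<close> by blast
    then have "s \<otimes> n \<otimes> inv s = s \<otimes> inv s \<otimes> m \<otimes> (s \<otimes> inv s)"
      using s N.subset by (simp only: m_assoc m_closed inv_closed N.mem_carrier)
    then show ?thesis using m(1) s N.mem_carrier by simp
  qed
  have "x \<otimes> n \<otimes> inv x \<in> N" if "x \<in> generate G S" "n \<in> N" for x n
    using that
  proof (induction arbitrary: n rule: generate.induct)
    case one
    then show ?case by (simp add: N.mem_carrier)
  next
    case (incl h)
    then show ?case by (simp add: S)
  next
    case (inv h)
    then show ?case using assms(5)[of h n] assms(3) by (metis inv_inv subsetD)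
  next
    case (eng h1 h2)
    have h: "h1 \<in> carrier G" "h2 \<in> carrier G" using eng assms(4) by blast+
    have "h1 \<otimes> (h2 \<otimes> n \<otimes> inv h2) \<otimes> inv h1 \<in> N" using eng by blast
    then show ?case using h eng.prems by (simp add: inv_mult_group m_assoc N.mem_carrier)
  qed
  then show ?thesis using assms(2,4) by (simp add: normal_inv_iff)
qed

lemma card_subgroup_prime_power:
  assumes "prime (p::nat)" "Coset.order G = p ^ n" "subgroup K G"
  obtains i where "i \<le> n" "card K = p ^ i"
proof -
  have "card K dvd p ^ n" using lagrange[OF assms(3)] assms(2) by (metis dvd_triv_right)
  then show ?thesis using divides_primepow_nat[OF assms(1)] that by blast
qed

lemma card_psubgroup_prime_power:
  assumes "prime (p::nat)" "Coset.order G = p ^ n" "subgroup K G" "subgroup L G" "K \<subset> L"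
  shows "p * card K \<le> card L"
proof -
  obtain i where i: "card K = p ^ i" by (rule card_subgroup_prime_power[OF assms(1-3)])
  obtain j where j: "card L = p ^ j" by (rule card_subgroup_prime_power[OF assms(1,2,4)])
  have "finite (carrier G)"
    using order_gt_0_iff_finite assms(2) prime_gt_0_nat[OF assms(1)] by simp
  then have "finite L" using subgroup.subset[OF assms(4)] finite_subset by blast
  then have "card K < card L" using assms(5) psubset_card_mono by blast
  then have "Suc i \<le> j"
    using i j prime_gt_1_nat[OF assms(1)] by (simp add: Suc_le_eq)
  then have "p ^ Suc i \<le> p ^ j"
    using prime_gt_0_nat[OF assms(1)] by (intro power_increasing) auto
  then show ?thesis by (simp add: i j)
qed

end

section \<open>Groups in $\Phi_9$\<close>

lemma (in group) inv_commutator: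
  assumes "x \<in> carrier G" "y \<in> carrier G"
  shows "inv (commutator G x y) = commutator G y x"
  using assms by (simp add: commutator_def inv_mult_group m_assoc)

lemma (in group) inv_conj_mult:
  assumes "x \<in> carrier G" "y \<in> carrier G" "g \<in> carrier G"
  shows "inv g \<otimes> (x \<otimes> y) \<otimes> g = (inv g \<otimes> x \<otimes> g) \<otimes> (inv g \<otimes> y \<otimes> g)"
  using assms by (simp add: m_assoc mult_inv_cancel)

lemma (in group) inv_conj_pow:
  fixes n :: nat
  assumes "x \<in> carrier G" "g \<in> carrier G"
  shows "(inv g \<otimes> x \<otimes> g) [^] n = inv g \<otimes> x [^] n \<otimes> g"
  using assms by (induction n) (simp_all add: m_assoc mult_inv_cancel)

locale phi9_group = group G for G (structure) +
  fixes p :: nat and g g1 g2 g3 g4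
  assumes p_prime: "prime p" and order_eq: "Coset.order G = p ^ 5"
    and gens_in_carrier: "{g, g1, g2, g3, g4} \<subseteq> carrier G"
    and generated: "generate G (group_center G \<union> {g, g1}) = carrier G"
    and commutators: "commutator G g1 g = g2" "commutator G g2 g = g3" "commutator G g3 g = g4"
      "commutator G g4 g = \<one>"
    and gens_commute: "\<And>x y. x \<in> {g1, g2, g3, g4} \<Longrightarrow> y \<in> {g1, g2, g3, g4} \<Longrightarrow> x \<otimes> y = y \<otimes> x"
    and g4_nontrivial: "g4 \<noteq> \<one>"
    and g2_pow: "g2 [^] p = \<one>"
begin

abbreviation "Z \<equiv> group_center G"
abbreviation "D \<equiv> derived_subgroup G"
abbreviation "Z2 \<equiv> center_mod G Z"
abbreviation "Z3 \<equiv> center_mod G Z2"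

definition B where "B = generate G (Z \<union> {g1, g2, g3, g4})"

lemma g_carrier [simp]: "g \<in> carrier G" "g1 \<in> carrier G" "g2 \<in> carrier G" "g3 \<in> carrier G" "g4 \<in> carrier G"
  using gens_in_carrier by auto

lemma finite_carrier: "finite (carrier G)"
  using order_gt_0_iff_finite order_eq prime_gt_0_nat[OF p_prime] by simp

lemma Z_carrier: "z \<in> Z \<Longrightarrow> z \<in> carrier G"
  by (simp add: group_center_def)

lemma Z_commute: "z \<in> Z \<Longrightarrow> x \<in> carrier G \<Longrightarrow> z \<otimes> x = x \<otimes> z"
  by (simp add: group_center_def)

lemma Z_subgroup: "subgroup Z G"
  using group_center_normal by (rule normal_imp_subgroup)

lemma B_subgroup: "subgroup B G"
  unfolding B_def by (rule generate_is_subgroup) (use Z_carrier in auto)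

sublocale B: subgroup B G by (rule B_subgroup)

lemma Z_subset_B: "Z \<subseteq> B" and gens_in_B [simp]: "g1 \<in> B" "g2 \<in> B" "g3 \<in> B" "g4 \<in> B"
  unfolding B_def by (auto intro: generate.incl)

lemma B_commute: "x \<in> B \<Longrightarrow> y \<in> B \<Longrightarrow> x \<otimes> y = y \<otimes> x"
  unfolding B_def
proof (rule generate_commute)
  show "Z \<union> {g1, g2, g3, g4} \<subseteq> carrier G" "Z \<union> {g1, g2, g3, g4} \<subseteq> carrier G"
    using Z_carrier by auto
  fix s t assume st: "s \<in> Z \<union> {g1, g2, g3, g4}" "t \<in> Z \<union> {g1, g2, g3, g4}"
  then have "s \<in> carrier G" "t \<in> carrier G" using Z_carrier by auto
  note carr = this
  consider "s \<in> Z" | "t \<in> Z" | "s \<in> {g1, g2, g3, g4}" "t \<in> {g1, g2, g3, g4}"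
    using st by blast
  then show "s \<otimes> t = t \<otimes> s"
  proof cases
    case 1
    then show ?thesis using carr by (intro Z_commute)
  next
    case 2
    then show ?thesis using carr by (intro Z_commute[symmetric])
  next
    case 3
    then show ?thesis by (rule gens_commute)
  qed
qed

lemma gens_normalized:
  assumes "h \<in> Z \<union> {g1, g2, g3, g4}" shows "inv g \<otimes> h \<otimes> g \<in> B"
proof (cases "h \<in> Z")
  case True
  then have "inv g \<otimes> h \<otimes> g = h"
    using Z_carrier Z_commute[of h "inv g"] Z_commute[of h g] by (simp add: m_assoc mult_inv_cancel)
  then show ?thesis using True Z_subset_B by auto
next
  case False
  with assms have h: "h \<in> {g1, g2, g3, g4}" by blast
  then have "commutator G h g \<in> B" "h \<in> B" by (auto simp: commutators)
  then show ?thesis by (simp add: conj_eq_mult_commutator)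
qed

lemma B_normalized: "n \<in> B \<Longrightarrow> inv g \<otimes> n \<otimes> g \<in> B"
  unfolding B_def
proof (induction rule: generate.induct)
  case one
  show ?case by (simp add: generate.one)
next
  case (incl h)
  then show ?case using gens_normalized unfolding B_def by blast
next
  case (inv h)
  then have h: "h \<in> carrier G" using Z_carrier by auto
  have "inv (inv g \<otimes> h \<otimes> g) \<in> B" using gens_normalized[OF inv] by simp
  then show ?case using h unfolding B_def[symmetric] by (simp add: inv_mult_group m_assoc)
next
  case (eng h1 h2)
  then have "h1 \<in> B" "h2 \<in> B" by (simp_all only: B_def)
  then have "h1 \<in> carrier G" "h2 \<in> carrier G" by auto
  then show ?case
    using eng.IH unfolding B_def[symmetric] by (simp add: inv_conj_mult)
qed

lemma B_normal: "B \<lhd> G"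
proof (rule normal_if_generators_normalize[OF finite_carrier B_subgroup _ generated])
  show "Z \<union> {g, g1} \<subseteq> carrier G" using Z_carrier by auto
  fix s n assume s: "s \<in> Z \<union> {g, g1}" and n: "n \<in> B"
  show "inv s \<otimes> n \<otimes> s \<in> B"
  proof (cases "s = g")
    case False
    then have "s \<in> B" using s Z_subset_B by auto
    then show ?thesis using n by simp
  qed (simp add: n B_normalized)
qed

lemma commutator_gens_in:
  assumes "subgroup N G" "g2 \<in> N" "s \<in> Z \<union> {g, g1}" "t \<in> Z \<union> {g, g1}"
  shows "commutator G s t \<in> N"
proof -
  have st: "s \<in> carrier G" "t \<in> carrier G" using assms Z_carrier by auto
  consider "s \<otimes> t = t \<otimes> s" | "s = g1" "t = g" | "s = g" "t = g1"
    using assms(3,4) st Z_commute Z_commute[symmetric] by blast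
  then show ?thesis
  proof cases
    case 1
    then show ?thesis using st assms(1) subgroup.one_closed by (simp add: commutator_eq_one_iff[THEN iffD2])
  next
    case 2
    then show ?thesis by (simp add: commutators assms)
  next
    case 3
    then show ?thesis
      using inv_commutator[of g1 g] subgroup.m_inv_closed[OF assms(1,2)] by (simp add: commutators)
  qed
qed

lemma D_subset_normal: "N \<lhd> G \<Longrightarrow> g2 \<in> N \<Longrightarrow> D \<subseteq> N"
proof (rule derived_subset_normal[OF _ _ generated])
  assume N: "N \<lhd> G" "g2 \<in> N"
  show "N \<lhd> G" by (rule N)
  show "Z \<union> {g, g1} \<subseteq> carrier G" using Z_carrier by auto
  show "commutator G s t \<in> N" if "s \<in> Z \<union> {g, g1}" "t \<in> Z \<union> {g, g1}" for s t
    using commutator_gens_in[OF normal_imp_subgroup N(2) that] N(1) by simp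
qed

lemma D_subset_B: "D \<subseteq> B"
  using D_subset_normal[OF B_normal] by simp

lemma center_mod_genI:
  assumes "N \<lhd> G" "x \<in> {g1, g2, g3, g4}" "commutator G x g \<in> N"
  shows "x \<in> center_mod G N"
proof (rule center_modI[OF assms(1) _ generated])
  show "Z \<union> {g, g1} \<subseteq> carrier G" using Z_carrier by auto
  show x: "x \<in> carrier G" using assms(2) by auto
  fix s assume s: "s \<in> Z \<union> {g, g1}"
  show "commutator G x s \<in> N"
  proof (cases "s = g")
    case False
    then have "s \<in> B" "x \<in> B" using s assms(2) Z_subset_B by auto
    then have "commutator G x s = \<one>"
      by (intro iffD2[OF commutator_eq_one_iff] B_commute) auto
    then show ?thesis using subgroup.one_closed[OF normal_imp_subgroup[OF assms(1)]] by simp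
  qed (simp add: assms)
qed

lemma g4_in_Z: "g4 \<in> Z"
  using center_mod_genI[OF one_is_normal, of g4] by (simp add: center_mod_trivial commutators)

lemma Z2_normal: "Z2 \<lhd> G" and Z_subset_Z2: "Z \<subseteq> Z2"
  using center_mod_normal[OF group_center_normal] by auto

lemma Z3_normal: "Z3 \<lhd> G" and Z2_subset_Z3: "Z2 \<subseteq> Z3"
  using center_mod_normal[OF Z2_normal] by auto

lemma g3_in: "g3 \<in> Z2" and g3_notin: "g3 \<notin> Z"
proof -
  show "g3 \<in> Z2"
    by (rule center_mod_genI[OF group_center_normal]) (simp_all add: commutators g4_in_Z)
  show "g3 \<notin> Z"
  proof
    assume "g3 \<in> Z"
    then have "g3 \<otimes> g = g \<otimes> g3" by (rule Z_commute) simp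
    from iffD2[OF commutator_eq_one_iff[OF g_carrier(4,1)] this] show False
      using g4_nontrivial by (simp add: commutators)
  qed
qed

lemma g2_in: "g2 \<in> Z3" and g2_notin: "g2 \<notin> Z2"
proof -
  show "g2 \<in> Z3" by (rule center_mod_genI[OF Z2_normal]) (simp_all add: commutators g3_in)
  show "g2 \<notin> Z2"
  proof
    assume "g2 \<in> Z2"
    then have "commutator G g2 g \<in> Z" by (rule center_modD) simp
    with g3_notin show False by (simp only: commutators)
  qed
qed

lemma g1_notin: "g1 \<notin> Z3"
proof
  assume "g1 \<in> Z3"
  then have "commutator G g1 g \<in> Z2" by (rule center_modD) simp
  with g2_notin show False by (simp only: commutators)
qed

lemma g3_g: "g3 \<otimes> g \<noteq> g \<otimes> g3"
  using commutator_eq_one_iff[OF g_carrier(4,1)] g4_nontrivial by (simp add: commutators)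

lemma g_notin_B: "g \<notin> B"
proof
  assume "g \<in> B"
  from g3_g B_commute[OF gens_in_B(3) this] show False by (rule notE)
qed

lemma card_Z: "card Z = p" and card_B: "card B = p ^ 4"
proof -
  note less = card_psubgroup_prime_power[OF p_prime order_eq]
  have sub: "subgroup (Z2 \<inter> B) G" "subgroup (Z3 \<inter> B) G"
    using Z2_normal Z3_normal B_subgroup normal_imp_subgroup subgroups_Inter_pair by blast+
  have "p * card {\<one>} \<le> card Z"
    using g4_in_Z g4_nontrivial subgroup.one_closed[OF Z_subgroup]
    by (intro less triv_subgroup Z_subgroup) auto
  then have 1: "p \<le> card Z" by simp
  have 2: "p * card Z \<le> card (Z2 \<inter> B)"
    using g3_in g3_notin Z_subset_Z2 Z_subset_B by (intro less Z_subgroup sub) auto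
  have 3: "p * card (Z2 \<inter> B) \<le> card (Z3 \<inter> B)"
    using g2_in g2_notin Z2_subset_Z3 by (intro less sub) auto
  have 4: "p * card (Z3 \<inter> B) \<le> card B"
    using g1_notin by (intro less sub B_subgroup) (auto intro: gens_in_B)
  have "B \<subset> carrier G" using g_notin_B B.subset g_carrier(1) by blast
  then have 5: "p * card B \<le> p ^ 5"
    using less[OF B_subgroup subgroup_self] order_eq by (simp add: Coset.order_def)
  have p0: "0 < p" using p_prime by (rule prime_gt_0_nat)
  have 6: "p ^ 3 * card Z \<le> card B"
  proof -
    have "p * (p * (p * card Z)) \<le> p * (p * card (Z2 \<inter> B))" using 2 by simp
    also have "\<dots> \<le> p * card (Z3 \<inter> B)" using 3 by simp
    also have "\<dots> \<le> card B" by (rule 4)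
    finally show ?thesis by (simp add: eval_nat_numeral mult.assoc)
  qed
  have 7: "card B \<le> p ^ 4"
  proof -
    have "p * card B \<le> p * p ^ 4" using 5 by (simp add: eval_nat_numeral mult.assoc)
    then show ?thesis using p0 by simp
  qed
  have "p ^ 3 * card Z \<le> p ^ 4" using 6 7 by (rule le_trans)
  also have "p ^ 4 = p ^ 3 * p" by (simp add: eval_nat_numeral mult.assoc)
  finally have "card Z \<le> p" using p0 nat_mult_le_cancel1[of "p ^ 3"] by simp
  with 1 show Z: "card Z = p" by simp
  have "p ^ 4 = p ^ 3 * p" by (simp add: eval_nat_numeral mult.assoc)
  with 6 7 show "card B = p ^ 4" unfolding Z by simp
qed

lemma B_maximal:
  assumes "subgroup S G" "B \<subseteq> S" shows "S = B \<or> S = carrier G"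
proof (rule ccontr)
  assume "\<not> ?thesis"
  then have "B \<subset> S" "S \<subset> carrier G" using assms subgroup.subset by blast+
  then have "p * card B \<le> card S" "p * card S \<le> card (carrier G)"
    using card_psubgroup_prime_power[OF p_prime order_eq] assms(1) B_subgroup subgroup_self by blast+
  then have "p * card B \<le> card S" "p * card S \<le> p ^ 5"
    using order_eq by (simp_all add: Coset.order_def)
  then have "p * (p * p ^ 4) \<le> p ^ 5"
    unfolding card_B by (meson le_trans mult_le_mono2)
  then have "p ^ 6 \<le> p ^ 5" by (simp add: eval_nat_numeral)
  then show False
    using prime_gt_1_nat[OF p_prime] power_strict_increasing[of 5 6 p] by simp
qed

lemma g_in_D: "g2 \<in> D" "g3 \<in> D" "g4 \<in> D"
  using commutator_in_derived commutators g_carrier by metis+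

lemma D_carrier: "d \<in> D \<Longrightarrow> d \<in> carrier G"
  using D_subset_B by auto

lemma D_normal: "D \<lhd> G"
  by (rule derived_self_is_normal)

lemma centralizer_D: "centralizer G D = B"
proof -
  have "D \<subseteq> carrier G" using D_carrier by blast
  moreover have "B \<subseteq> centralizer G D"
    using D_subset_B B_commute by (auto simp: centralizer_def)
  moreover have "g \<notin> centralizer G D"
    using g3_g g_in_D(2) by (force simp: centralizer_def)
  ultimately show ?thesis using B_maximal[OF centralizer_subgroup] g_carrier(1) by blast
qed

lemma Z_eq_generate: "Z = generate G {g4}"
proof (rule ccontr)
  have sub: "generate G {g4} \<subseteq> Z"
    using generate_subgroup_incl[OF _ Z_subgroup] g4_in_Z by blast
  have gen: "subgroup (generate G {g4}) G" by (simp add: generate_is_subgroup)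
  assume "Z \<noteq> generate G {g4}"
  then have "p * card (generate G {g4}) \<le> p * 1"
    using card_psubgroup_prime_power[OF p_prime order_eq gen Z_subgroup] sub card_Z by auto
  then have "card (generate G {g4}) \<le> 1"
    using prime_gt_0_nat[OF p_prime] by simp
  moreover have "{\<one>, g4} \<subseteq> generate G {g4}" by (auto intro: generate.intros)
  then have "card {\<one>, g4} \<le> card (generate G {g4})"
    using finite_subset[OF subgroup.subset[OF gen] finite_carrier] card_mono by blast
  ultimately show False using g4_nontrivial by simp
qed

lemma D_pow: assumes "d \<in> D" shows "d [^] p = \<one>"
proof -
  let ?N = "{x \<in> B. x [^] p = \<one>}"
  have sub: "subgroup ?N G"
  proof
    show "?N \<subseteq> carrier G" by auto
    show "\<one> \<in> ?N" by simp
    fix x assume x: "x \<in> ?N"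
    then show "inv x \<in> ?N" by (simp add: nat_pow_inv)
    fix y assume "y \<in> ?N"
    then show "x \<otimes> y \<in> ?N" using x by (simp add: pow_mult_distrib[OF B_commute])
  qed
  have "x \<otimes> n \<otimes> inv x \<in> ?N" if "x \<in> carrier G" "n \<in> ?N" for x n
    using that inv_conj_pow[of n "inv x" p] normal.inv_op_closed2[OF B_normal, of x n] by simp
  then have "?N \<lhd> G" using sub by (simp add: normal_inv_iff)
  then have "D \<subseteq> ?N" by (rule D_subset_normal) (simp add: g2_pow)
  then show ?thesis using assms by blast
qed

lemma B_pow_in_Z: assumes a: "a \<in> B" shows "a [^] p \<in> Z"
proof -
  have "a [^] p \<otimes> x = x \<otimes> a [^] p" if x: "x \<in> carrier G" for x
  proof -
    have c: "commutator G a x \<in> D" using a x by (simp add: commutator_in_derived)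
    have "inv x \<otimes> a [^] p \<otimes> x = (a \<otimes> commutator G a x) [^] p"
      using a x by (simp flip: inv_conj_pow conj_eq_mult_commutator)
    also have "\<dots> = a [^] p"
      using a c D_subset_B D_carrier by (subst pow_mult_distrib) (auto simp: D_pow intro: B_commute)
    finally have "x \<otimes> (inv x \<otimes> a [^] p \<otimes> x) = x \<otimes> a [^] p" by simp
    then show ?thesis using a x by (simp add: m_assoc mult_inv_cancel)
  qed
  then show ?thesis using a by (simp add: group_center_def)
qed

lemma D_subset_Z3: "D \<subseteq> Z3"
  using D_subset_normal[OF Z3_normal g2_in] .

end

lemma (in group_hom) hom_commutator:
  assumes "x \<in> carrier G" "y \<in> carrier G"
  shows "h (commutator G x y) = commutator H (h x) (h y)"
  using assms by (simp add: commutator_def)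

lemma (in group) phi9_group_exists:
  assumes "prime p" "p \<ge> 5" "Coset.order G = p ^ 5" "in_Phi9 p G"
  obtains g g1 g2 g3 g4 where "phi9_group G p g g1 g2 g3 g4"
proof -
  define H where "H = phi9_1_5 p"
  interpret H: group H unfolding H_def phi9_1_5_def by (rule presented_group_is_group)
  obtain a a1 a2 a3 a4 where a: "{a, a1, a2, a3, a4} \<subseteq> carrier H"
      and a_gen: "generate H {a, a1} = carrier H"
      and a_comm: "commutator H a1 a = a2" "commutator H a2 a = a3" "commutator H a3 a = a4"
        "commutator H a4 a = \<one>\<^bsub>H\<^esub>" and a4: "a4 \<noteq> \<one>\<^bsub>H\<^esub>"
      and a_abel: "\<And>x y. x \<in> {a1, a2, a3, a4} \<Longrightarrow> y \<in> {a1, a2, a3, a4} \<Longrightarrow> commutator H x y = \<one>\<^bsub>H\<^esub>"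
      and a_pow: "\<And>x. x \<in> {a, a1, a2, a3, a4} \<Longrightarrow> x [^]\<^bsub>H\<^esub> p = \<one>\<^bsub>H\<^esub>"
    using phi9_group_structure[OF assms(1,2)] unfolding H_def by blast
  let ?ZG = "group_center G" and ?ZH = "group_center H"
  let ?D = "derived_subgroup G" and ?DH = "derived_subgroup H"
  interpret ZG: normal ?ZG G by (rule group_center_normal)
  interpret ZH: normal ?ZH H by (rule H.group_center_normal)
  interpret QG: group "G Mod ?ZG" by (rule ZG.factorgroup_is_group)
  interpret QH: group "H Mod ?ZH" by (rule ZH.factorgroup_is_group)
  obtain \<phi> \<theta> where \<phi>: "\<phi> \<in> iso (G Mod ?ZG) (H Mod ?ZH)"
      and \<theta>: "\<theta> \<in> iso (G\<lparr>carrier := ?D\<rparr>) (H\<lparr>carrier := ?DH\<rparr>)"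
      and compat: "\<And>x y x' y'. x \<in> carrier G \<Longrightarrow> y \<in> carrier G \<Longrightarrow> x' \<in> carrier H \<Longrightarrow> y' \<in> carrier H \<Longrightarrow>
         \<phi> (?ZG #> x) = ?ZH #>\<^bsub>H\<^esub> x' \<Longrightarrow> \<phi> (?ZG #> y) = ?ZH #>\<^bsub>H\<^esub> y' \<Longrightarrow>
         \<theta> (commutator G x y) = commutator H x' y'"
    using assms(4) unfolding in_Phi9_def isoclinic_def H_def[symmetric] by blast
  define f where "f x = \<phi> (?ZG #> x)" for x
  define k where "k x = ?ZH #>\<^bsub>H\<^esub> x" for x
  have "f \<in> hom G (H Mod ?ZH)"
    using Group.hom_compose[OF ZG.r_coset_hom_Mod, of \<phi> "H Mod ?ZH"] \<phi>
    by (simp add: iso_def f_def[abs_def] comp_def)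
  then interpret f: group_hom G "H Mod ?ZH" f by unfold_locales
  interpret k: group_hom H "H Mod ?ZH" k
    unfolding k_def by unfold_locales (rule ZH.r_coset_hom_Mod)
  have f_surj: "\<exists>x \<in> carrier G. f x = k x'" if "x' \<in> carrier H" for x'
  proof -
    have "k x' \<in> \<phi> ` carrier (G Mod ?ZG)"
      using \<phi> k.hom_closed[OF that] by (simp add: iso_def bij_betw_def)
    then show ?thesis unfolding carrier_FactGroup f_def by auto
  qed
  have f_inj: "?ZG #> x = ?ZG #> y" if "x \<in> carrier G" "y \<in> carrier G" "f x = f y" for x y
  proof -
    have "inj_on \<phi> (carrier (G Mod ?ZG))" using \<phi> by (simp add: iso_def bij_betw_def)
    then show ?thesis using that unfolding carrier_FactGroup f_def by (auto dest: inj_onD)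
  qed
  interpret D: group "G\<lparr>carrier := ?D\<rparr>"
    by (intro subgroup_imp_group derived_is_subgroup) simp
  interpret DH: group "H\<lparr>carrier := ?DH\<rparr>"
    by (intro H.subgroup_imp_group H.derived_is_subgroup) simp
  interpret \<theta>: group_hom "G\<lparr>carrier := ?D\<rparr>" "H\<lparr>carrier := ?DH\<rparr>" \<theta>
    using \<theta> by unfold_locales (simp add: iso_def)
  have \<theta>_inj: "inj_on \<theta> ?D" using \<theta> by (simp add: iso_def bij_betw_def)
  have one_D: "\<one> \<in> ?D" using D.one_closed by simp
  have \<theta>_one: "\<theta> \<one> = \<one>\<^bsub>H\<^esub>" using \<theta>.hom_one by simp
  have \<theta>_one_iff: "d = \<one> \<longleftrightarrow> \<theta> d = \<one>\<^bsub>H\<^esub>" if "d \<in> ?D" for d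
    using inj_onD[OF \<theta>_inj _ that one_D] \<theta>_one by auto
  define rel where "rel x x' \<longleftrightarrow> x \<in> carrier G \<and> x' \<in> carrier H \<and> f x = k x'" for x x'
  have rel_comm: "rel (commutator G x y) (commutator H x' y')"
    and \<theta>_comm: "\<theta> (commutator G x y) = commutator H x' y'"
    and comm_one_iff: "commutator G x y = \<one> \<longleftrightarrow> commutator H x' y' = \<one>\<^bsub>H\<^esub>"
    if "rel x x'" "rel y y'" for x y x' y'
  proof -
    show "rel (commutator G x y) (commutator H x' y')"
      using that by (simp add: rel_def f.hom_commutator k.hom_commutator)
    show \<theta>: "\<theta> (commutator G x y) = commutator H x' y'"
      using that by (intro compat) (simp_all add: rel_def f_def k_def)
    show "commutator G x y = \<one> \<longleftrightarrow> commutator H x' y' = \<one>\<^bsub>H\<^esub>"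
      using \<theta>_one_iff[OF commutator_in_derived, of x y] that by (simp add: \<theta> rel_def)
  qed
  obtain g where g: "rel g a" using f_surj[of a] a by (auto simp: rel_def)
  obtain g1 where g1: "rel g1 a1" using f_surj[of a1] a by (auto simp: rel_def)
  define g2 where "g2 = commutator G g1 g"
  define g3 where "g3 = commutator G g2 g"
  define g4 where "g4 = commutator G g3 g"
  have g2: "rel g2 a2" using rel_comm[OF g1 g] by (simp add: g2_def a_comm)
  have g3: "rel g3 a3" using rel_comm[OF g2 g] by (simp add: g3_def a_comm)
  have g4: "rel g4 a4" using rel_comm[OF g3 g] by (simp add: g4_def a_comm)
  have carr: "{g, g1, g2, g3, g4} \<subseteq> carrier G" using g g1 g2 g3 g4 by (simp add: rel_def)
  have "x \<in> generate G (?ZG \<union> {g, g1})" if x: "x \<in> carrier G" for x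
  proof -
    let ?S = "?ZG \<union> {g, g1}"
    have S: "?S \<subseteq> carrier G" using carr ZG.subset by auto
    have "f x \<in> k ` carrier H"
      using f.hom_closed[OF x] unfolding carrier_FactGroup k_def .
    also have "k ` carrier H = generate (H Mod ?ZH) (k ` {a, a1})"
      using k.generate_img[of "{a, a1}"] a by (simp add: a_gen)
    also have "k ` {a, a1} = f ` {g, g1}" using g g1 by (simp add: rel_def)
    also have "generate (H Mod ?ZH) (f ` {g, g1}) = f ` generate G {g, g1}"
      using carr by (intro f.generate_img) auto
    finally obtain y where y: "y \<in> generate G {g, g1}" "f x = f y" by blast
    have y': "y \<in> generate G ?S" using mono_generate[of "{g, g1}" ?S] y(1) by blast
    then have yG: "y \<in> carrier G" using generate_incl[OF S] by blast
    have "x \<in> ?ZG #> y"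
      using f_inj[OF x yG y(2)] rcos_self[OF x ZG.subgroup_axioms] by simp
    then obtain z where z: "z \<in> ?ZG" "x = z \<otimes> y" by (auto simp: r_coset_def)
    have "z \<in> generate G ?S" using z(1) by (intro generate.incl) simp
    then show ?thesis unfolding z(2) using y' by (rule generate.eng)
  qed
  moreover have "generate G (?ZG \<union> {g, g1}) \<subseteq> carrier G"
    using carr ZG.subset by (intro generate_incl) auto
  ultimately have gen: "generate G (?ZG \<union> {g, g1}) = carrier G" by blast
  have abel: "x \<otimes> y = y \<otimes> x" if xy: "x \<in> {g1, g2, g3, g4}" "y \<in> {g1, g2, g3, g4}" for x y
  proof -
    have ex: "\<exists>x' \<in> {a1, a2, a3, a4}. rel x x'" if "x \<in> {g1, g2, g3, g4}" for x
      using that g1 g2 g3 g4 by blast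
    obtain x' y' where "x' \<in> {a1, a2, a3, a4}" "y' \<in> {a1, a2, a3, a4}" "rel x x'" "rel y y'"
      using ex[OF xy(1)] ex[OF xy(2)] by blast
    then have "commutator G x y = \<one>" using comm_one_iff a_abel by blast
    moreover have "x \<in> carrier G" "y \<in> carrier G" using xy carr by auto
    ultimately show ?thesis by (rule iffD1[OF commutator_eq_one_iff, rotated 2])
  qed
  have g4_ne: "g4 \<noteq> \<one>"
    using comm_one_iff[OF g3 g] a4 by (simp add: a_comm flip: g4_def)
  have g4_g: "commutator G g4 g = \<one>"
    using comm_one_iff[OF g4 g] by (simp add: a_comm)
  have g2_D: "g2 \<in> ?D" using g g1 by (simp add: g2_def commutator_in_derived rel_def)
  have "\<theta> (g2 [^] p) = \<theta> g2 [^]\<^bsub>H\<^esub> p"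
    using \<theta>.hom_nat_pow[of g2 p] g2_D by (simp flip: nat_pow_consistent H.nat_pow_consistent)
  also have "\<dots> = \<one>\<^bsub>H\<^esub>" using \<theta>_comm[OF g1 g] by (simp add: a_pow a_comm flip: g2_def)
  finally have g2_pow: "g2 [^] p = \<one>"
    using \<theta>_one_iff[of "g2 [^] p"] D.nat_pow_closed[of g2 p] g2_D
    by (simp flip: nat_pow_consistent)
  have "phi9_group G p g g1 g2 g3 g4"
    by unfold_locales
      (use assms(1,3) carr gen abel g4_ne g2_pow g4_g g2_def g3_def g4_def in blast)+
  then show thesis by (rule that)
qed

section \<open>Characters of abelian groups and character fields\<close>

lemma subspace_vecI:
  assumes "W \<subseteq> carrier_vec n" "0\<^sub>v n \<in> W" "\<And>v w. v \<in> W \<Longrightarrow> w \<in> W \<Longrightarrow> v + w \<in> W"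
    and "\<And>c v. v \<in> W \<Longrightarrow> c \<cdot>\<^sub>v v \<in> W"
  shows "subspace class_ring W (module_vec TYPE('a :: field) n)"
proof (rule subspace.intro[OF vec_vs])
  show "LinearCombinations.submodule class_ring W (module_vec TYPE('a) n)"
    by (rule LinearCombinations.submodule.intro)
      (use assms in \<open>auto simp: module_vec_simps vec_module\<close>)
qed

lemma representation_simps:
  assumes "representation G n \<rho>"
  shows "g \<in> carrier G \<Longrightarrow> \<rho> g \<in> carrier_mat n n"
    and "g \<in> carrier G \<Longrightarrow> h \<in> carrier G \<Longrightarrow> \<rho> (g \<otimes>\<^bsub>G\<^esub> h) = \<rho> g * \<rho> h"
proof -
  have hom: "\<rho> \<in> hom G (units_of (ring_mat TYPE(complex) n ()))"
    using assms by (simp add: representation_def)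
  show "\<rho> g \<in> carrier_mat n n" if "g \<in> carrier G"
    using hom_in_carrier[OF hom that] by (simp add: units_of_carrier Units_def ring_mat_simps)
  show "\<rho> (g \<otimes>\<^bsub>G\<^esub> h) = \<rho> g * \<rho> h" if "g \<in> carrier G" "h \<in> carrier G"
    using hom_mult[OF hom that] by (simp add: units_of_mult ring_mat_simps)
qed

lemma irreducible_commuting_scalar:
  assumes irr: "irreducible_representation G n \<rho>"
    and comm: "\<And>x y. x \<in> carrier G \<Longrightarrow> y \<in> carrier G \<Longrightarrow> x \<otimes>\<^bsub>G\<^esub> y = y \<otimes>\<^bsub>G\<^esub> x"
    and g: "g \<in> carrier G"
  obtains c where "\<And>w. w \<in> carrier_vec n \<Longrightarrow> \<rho> g *\<^sub>v w = c \<cdot>\<^sub>v w"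
proof -
  have rep: "representation G n \<rho>" and n: "0 < n"
    using irr by (simp_all add: irreducible_representation_def)
  note \<rho> = representation_simps[OF rep]
  obtain c where "eigenvalue (\<rho> g) c"
    using spectrum_non_empty[OF \<rho>(1)[OF g] n] by (auto simp: spectrum_def)
  then obtain v where v: "v \<in> carrier_vec n" "v \<noteq> 0\<^sub>v n" "\<rho> g *\<^sub>v v = c \<cdot>\<^sub>v v"
    using \<rho>(1)[OF g] by (auto simp: eigenvalue_def eigenvector_def)
  define W where "W = {w \<in> carrier_vec n. \<rho> g *\<^sub>v w = c \<cdot>\<^sub>v w}"
  have "subspace class_ring W (module_vec TYPE(complex) n)"
  proof (rule subspace_vecI)
    show "W \<subseteq> carrier_vec n" by (auto simp: W_def)
    show "0\<^sub>v n \<in> W" using \<rho>(1)[OF g] by (auto simp: W_def)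
    show "v + w \<in> W" if "v \<in> W" "w \<in> W" for v w
      using that mult_add_distrib_mat_vec[OF \<rho>(1)[OF g], of v w]
      by (auto simp: W_def smult_add_distrib_vec)
    show "k \<cdot>\<^sub>v v \<in> W" if "v \<in> W" for k v
      using that mult_mat_vec[OF \<rho>(1)[OF g], of v k]
      by (auto simp: W_def smult_smult_assoc mult.commute)
  qed
  moreover have "\<rho> h *\<^sub>v w \<in> W" if "h \<in> carrier G" "w \<in> W" for h w
  proof -
    have w: "w \<in> carrier_vec n" "\<rho> g *\<^sub>v w = c \<cdot>\<^sub>v w" using that(2) by (auto simp: W_def)
    have "\<rho> g *\<^sub>v (\<rho> h *\<^sub>v w) = \<rho> (g \<otimes>\<^bsub>G\<^esub> h) *\<^sub>v w"
      using assoc_mult_mat_vec[OF \<rho>(1)[OF g] \<rho>(1)[OF that(1)] w(1)] \<rho>(2)[OF g that(1)] by simp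
    also have "\<dots> = \<rho> h *\<^sub>v (\<rho> g *\<^sub>v w)"
      using assoc_mult_mat_vec[OF \<rho>(1)[OF that(1)] \<rho>(1)[OF g] w(1)] \<rho>(2)[OF that(1) g]
        comm[OF g that(1)] by simp
    also have "\<dots> = c \<cdot>\<^sub>v (\<rho> h *\<^sub>v w)"
      unfolding w(2) by (rule mult_mat_vec[OF \<rho>(1)[OF that(1)] w(1)])
    finally show ?thesis using w(1) \<rho>(1)[OF that(1)] by (auto simp: W_def)
  qed
  ultimately have "W = {0\<^sub>v n} \<or> W = carrier_vec n"
    using irr unfolding irreducible_representation_def by blast
  moreover have "v \<in> W" using v by (simp add: W_def)
  ultimately have "W = carrier_vec n" using v(2) by blast
  then show ?thesis using that[of c] by (auto simp: W_def)
qed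

lemma irreducible_commuting_dim_one:
  assumes irr: "irreducible_representation G n \<rho>"
    and comm: "\<And>x y. x \<in> carrier G \<Longrightarrow> y \<in> carrier G \<Longrightarrow> x \<otimes>\<^bsub>G\<^esub> y = y \<otimes>\<^bsub>G\<^esub> x"
  shows "n = 1"
proof (rule ccontr)
  have n: "0 < n" using irr by (simp add: irreducible_representation_def)
  assume "n \<noteq> 1"
  with n have n2: "1 < n" by simp
  let ?e = "unit_vec n 0 :: complex vec"
  define W where "W = range (\<lambda>k. k \<cdot>\<^sub>v ?e)"
  have "subspace class_ring W (module_vec TYPE(complex) n)"
  proof (rule subspace_vecI)
    show "W \<subseteq> carrier_vec n" by (auto simp: W_def)
    have "0\<^sub>v n = 0 \<cdot>\<^sub>v ?e" by auto
    then show "0\<^sub>v n \<in> W" unfolding W_def by blast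
    show "v + w \<in> W" if vw: "v \<in> W" "w \<in> W" for v w
    proof -
      obtain k l where "v = k \<cdot>\<^sub>v ?e" "w = l \<cdot>\<^sub>v ?e" using vw by (auto simp: W_def)
      then have "v + w = (k + l) \<cdot>\<^sub>v ?e" by (simp add: add_smult_distrib_vec)
      then show ?thesis unfolding W_def by blast
    qed
    show "k \<cdot>\<^sub>v v \<in> W" if "v \<in> W" for k v
      using that by (auto simp: W_def smult_smult_assoc)
  qed
  moreover have "\<rho> g *\<^sub>v w \<in> W" if gw: "g \<in> carrier G" "w \<in> W" for g w
  proof -
    obtain c where c: "\<And>w. w \<in> carrier_vec n \<Longrightarrow> \<rho> g *\<^sub>v w = c \<cdot>\<^sub>v w"
      using irreducible_commuting_scalar[OF irr comm gw(1)] by blast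
    obtain k where "w = k \<cdot>\<^sub>v ?e" using gw(2) by (auto simp: W_def)
    then show ?thesis using c[of w] by (auto simp: W_def smult_smult_assoc)
  qed
  ultimately have "W = {0\<^sub>v n} \<or> W = carrier_vec n"
    using irr unfolding irreducible_representation_def by blast
  moreover have "?e \<in> W" using one_smult_vec[of ?e] unfolding W_def by (metis rangeI)
  moreover have "?e \<noteq> 0\<^sub>v n"
    using n by (auto dest!: arg_cong[of _ _ "\<lambda>v. v $ 0"])
  moreover have "unit_vec n 1 \<in> (carrier_vec n :: complex vec set)" by simp
  ultimately obtain k where "unit_vec n 1 = k \<cdot>\<^sub>v ?e" unfolding W_def by blast
  then have "unit_vec n 1 $ 1 = (k \<cdot>\<^sub>v ?e) $ 1" by simp
  then show False using n2 by simp
qed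

lemma Irr_commuting_is_hom:
  assumes "group G" "\<psi> \<in> Irr G"
    and comm: "\<And>x y. x \<in> carrier G \<Longrightarrow> y \<in> carrier G \<Longrightarrow> x \<otimes>\<^bsub>G\<^esub> y = y \<otimes>\<^bsub>G\<^esub> x"
  shows "\<psi> \<one>\<^bsub>G\<^esub> = 1"
    and "\<And>x y. x \<in> carrier G \<Longrightarrow> y \<in> carrier G \<Longrightarrow> \<psi> (x \<otimes>\<^bsub>G\<^esub> y) = \<psi> x * \<psi> y"
proof -
  interpret group G by (rule assms(1))
  obtain n \<rho> where irr: "irreducible_representation G n \<rho>" and \<psi>: "\<psi> = rep_character G n \<rho>"
    using assms(2) by (auto simp: Irr_def)
  have n: "n = 1" using irreducible_commuting_dim_one[OF irr comm] .
  have rep: "representation G 1 \<rho>" using irr by (simp add: irreducible_representation_def n)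
  interpret R: ring "ring_mat TYPE(complex) 1 ()" by (rule ring_mat)
  interpret U: group "units_of (ring_mat TYPE(complex) 1 ())" by (rule R.units_group)
  interpret \<rho>: group_hom G "units_of (ring_mat TYPE(complex) 1 ())" \<rho>
    using rep by unfold_locales (simp add: representation_def)
  have \<psi>_eq: "\<psi> x = \<rho> x $$ (0, 0)" if "x \<in> carrier G" for x
    using that by (simp add: \<psi> n rep_character_def)
  show "\<psi> \<one>\<^bsub>G\<^esub> = 1"
    using \<rho>.hom_one by (simp add: \<psi>_eq units_of_one ring_mat_simps)
  show "\<psi> (x \<otimes>\<^bsub>G\<^esub> y) = \<psi> x * \<psi> y" if "x \<in> carrier G" "y \<in> carrier G" for x y
    using that representation_simps[OF rep, of x] representation_simps[OF rep, of y]
    by (auto simp: \<psi>_eq representation_simps(2)[OF rep] scalar_prod_def)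
qed

lemma char_field_incl: "x \<in> carrier G \<Longrightarrow> \<chi> x \<in> char_field G \<chi>"
  and char_field_Rats: "q \<in> \<rat> \<Longrightarrow> q \<in> char_field G \<chi>"
  unfolding char_field_def by (auto intro: generate_field.incl)

lemma char_field_add: "x \<in> char_field G \<chi> \<Longrightarrow> y \<in> char_field G \<chi> \<Longrightarrow> x + y \<in> char_field G \<chi>"
  using generate_field.eng_add[of x class_ring _ y] by (simp add: char_field_def)

lemma char_field_mult: "x \<in> char_field G \<chi> \<Longrightarrow> y \<in> char_field G \<chi> \<Longrightarrow> x * y \<in> char_field G \<chi>"
  using generate_field.eng_mult[of x class_ring _ y] by (simp add: char_field_def)

lemma char_field_inverse: "x \<in> char_field G \<chi> \<Longrightarrow> inverse x \<in> char_field G \<chi>"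
  using generate_field.m_inv[of x class_ring "\<rat> \<union> \<chi> ` carrier G"]
  by (cases "x = 0") (simp_all add: char_field_def class_ring_simps)

lemma char_field_divide: "x \<in> char_field G \<chi> \<Longrightarrow> y \<in> char_field G \<chi> \<Longrightarrow> x / y \<in> char_field G \<chi>"
  unfolding divide_inverse by (intro char_field_mult char_field_inverse)

lemma char_field_power: "x \<in> char_field G \<chi> \<Longrightarrow> x ^ k \<in> char_field G \<chi>"
  by (induction k) (auto intro: char_field_mult char_field_Rats)

lemma char_field_sum: "(\<And>i. i \<in> I \<Longrightarrow> f i \<in> char_field G \<chi>) \<Longrightarrow> sum f I \<in> char_field G \<chi>"
  by (induction I rule: infinite_finite_induct) (auto intro: char_field_add char_field_Rats)

lemma char_field_least:
  assumes "\<And>x. x \<in> carrier H \<Longrightarrow> \<psi> x \<in> char_field G \<chi>"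
  shows "char_field H \<psi> \<subseteq> char_field G \<chi>"
proof
  fix x assume "x \<in> char_field H \<psi>"
  then show "x \<in> char_field G \<chi>"
    unfolding char_field_def[of H]
  proof (induction rule: generate_field.induct)
    case (incl h)
    then show ?case using assms char_field_Rats by blast
  next
    case (a_inv h)
    then have "(-1) * h \<in> char_field G \<chi>"
      by (intro char_field_mult) (simp_all add: char_field_Rats)
    then show ?case by (simp add: class_ring_simps)
  qed (simp_all add: class_ring_simps char_field_Rats char_field_add char_field_mult
      char_field_inverse)
qed

lemma prime_root_of_unity_power:
  fixes \<zeta> w :: complex
  assumes "prime p" "\<zeta> ^ p = 1" "\<zeta> \<noteq> 1" "w ^ p = 1"
  obtains k where "w = \<zeta> ^ k"
proof -
  have p: "0 < p" using assms(1) by (rule prime_gt_0_nat)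
  have \<zeta>0: "\<zeta> \<noteq> 0" using assms(2) p by (auto simp: zero_power)
  have ne1: "\<zeta> ^ k \<noteq> 1" if "0 < k" "k < p" for k
  proof
    assume k: "\<zeta> ^ k = 1"
    have "coprime p k" using that assms(1) by (intro prime_imp_coprime) (auto dest: dvd_imp_le)
    then have "gcd k p = 1" by (simp add: coprime_iff_gcd_eq_1 gcd.commute)
    then obtain x y where "k * x = p * y + 1"
      using bezout_nat[of k p] \<open>0 < k\<close> by auto
    then have "\<zeta> ^ (k * x) = \<zeta> ^ (p * y + 1)" by simp
    then show False using k assms(2,3) by (simp add: power_mult power_add)
  qed
  have "inj_on (\<lambda>k. \<zeta> ^ k) {..<p}"
  proof (rule linorder_inj_onI)
    fix i j assume "i < j" "i \<in> {..<p}" "j \<in> {..<p}"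
    then have "\<zeta> ^ j = \<zeta> ^ i * \<zeta> ^ (j - i)" "\<zeta> ^ (j - i) \<noteq> 1"
      using ne1[of "j - i"] by (auto simp flip: power_add)
    then show "\<zeta> ^ i \<noteq> \<zeta> ^ j" using \<zeta>0 by simp
  qed auto
  then have "card ((\<lambda>k. \<zeta> ^ k) ` {..<p}) = card {z :: complex. z ^ p = 1}"
    using p by (simp add: card_image card_roots_unity_eq)
  moreover have "(\<lambda>k. \<zeta> ^ k) ` {..<p} \<subseteq> {z. z ^ p = 1}"
    using assms(2) by (auto simp: power_commutes simp flip: power_mult)
      (metis mult.commute power_mult power_one)
  moreover have "finite {z :: complex. z ^ p = 1}" using p by (intro finite_roots_unity) simp
  ultimately have "(\<lambda>k. \<zeta> ^ k) ` {..<p} = {z. z ^ p = 1}" by (intro card_subset_eq)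
  then show ?thesis using assms(4) that by blast
qed

section \<open>Induction from the centralizer of the derived subgroup\<close>

lemma (in group) sum_character_eq_0:
  fixes \<mu> :: "'a \<Rightarrow> complex"
  assumes "subgroup K G" "\<And>x y. x \<in> K \<Longrightarrow> y \<in> K \<Longrightarrow> \<mu> (x \<otimes> y) = \<mu> x * \<mu> y"
    and "b \<in> K" "\<mu> b \<noteq> 1"
  shows "(\<Sum>x\<in>K. \<mu> x) = 0"
proof -
  interpret K: subgroup K G by (rule assms(1))
  have "bij_betw (\<lambda>x. b \<otimes> x) K K"
    by (rule bij_betwI[where g = "\<lambda>x. inv b \<otimes> x"])
      (use assms(3) in \<open>auto simp: mult_inv_cancel\<close>)
  then have "(\<Sum>x\<in>K. \<mu> x) = (\<Sum>x\<in>K. \<mu> (b \<otimes> x))"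
    by (rule sum.reindex_bij_betw[symmetric])
  also have "\<dots> = \<mu> b * (\<Sum>x\<in>K. \<mu> x)"
    using assms(2,3) by (simp add: sum_distrib_left)
  finally have "(1 - \<mu> b) * (\<Sum>x\<in>K. \<mu> x) = 0" by (simp add: algebra_simps)
  then show ?thesis using assms(4) by simp
qed

locale phi9_character = phi9_group +
  fixes \<psi> :: "'a \<Rightarrow> complex"
  assumes \<psi>_one: "\<psi> \<one> = 1"
    and \<psi>_mult: "\<And>x y. x \<in> B \<Longrightarrow> y \<in> B \<Longrightarrow> \<psi> (x \<otimes> y) = \<psi> x * \<psi> y"
    and \<psi>_D: "\<exists>d\<in>D. \<psi> d \<noteq> 1"
begin

abbreviation "\<chi> \<equiv> induced_char G B \<psi>"
abbreviation "F \<equiv> char_field G \<chi>"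

lemma \<psi>_inv: "x \<in> B \<Longrightarrow> \<psi> x * \<psi> (inv x) = 1"
  using \<psi>_mult[of x "inv x"] by (simp add: \<psi>_one)

lemma \<psi>_nonzero: "x \<in> B \<Longrightarrow> \<psi> x \<noteq> 0"
  using \<psi>_inv[of x] by auto

lemma \<psi>_pow: "x \<in> B \<Longrightarrow> \<psi> (x [^] (k::nat)) = \<psi> x ^ k"
proof (induction k)
  case (Suc k)
  have "x [^] k \<in> B" using Suc.prems by (induction k) auto
  then show ?case using Suc by (simp add: \<psi>_mult)
qed (simp add: \<psi>_one)

lemma conj_in_B: "a \<in> B \<Longrightarrow> x \<in> carrier G \<Longrightarrow> x \<otimes> a \<otimes> inv x \<in> B"
  using normal.inv_op_closed2[OF B_normal] by blast

lemma conj_in_D: "b \<in> D \<Longrightarrow> x \<in> carrier G \<Longrightarrow> x \<otimes> b \<otimes> inv x \<in> D"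
  using normal.inv_op_closed2[OF D_normal] by blast

lemma conj_trivial: "a \<in> B \<Longrightarrow> x \<in> B \<Longrightarrow> x \<otimes> a \<otimes> inv x = a"
proof -
  assume a: "a \<in> B" "x \<in> B"
  then have "x \<otimes> a \<otimes> inv x = a \<otimes> x \<otimes> inv x" by (simp only: B_commute[of x a])
  also have "\<dots> = a" using a by (simp add: m_assoc)
  finally show ?thesis .
qed

lemma \<chi>_on_B:
  assumes "a \<in> B"
  shows "\<chi> a = (\<Sum>x\<in>carrier G. \<psi> (x \<otimes> a \<otimes> inv x)) / of_nat (card B)"
  using assms conj_in_B by (simp add: induced_char_def Let_def)

lemma \<psi>_in_F_if_invariant:
  assumes b: "b \<in> B" and inv: "\<And>x. x \<in> carrier G \<Longrightarrow> \<psi> (x \<otimes> b \<otimes> inv x) = \<psi> b"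
  shows "\<psi> b \<in> F"
proof -
  have "\<chi> b = of_nat (Coset.order G) / of_nat (card B) * \<psi> b"
    by (simp add: \<chi>_on_B b inv Coset.order_def)
  then have "\<psi> b = of_nat (card B) / of_nat (Coset.order G) * \<chi> b"
    using prime_gt_0_nat[OF p_prime] by (simp add: card_B order_eq)
  moreover have "of_nat (card B) / of_nat (Coset.order G) * \<chi> b \<in> F"
  proof (rule char_field_mult)
    show "of_nat (card B) / of_nat (Coset.order G) \<in> F" by (intro char_field_Rats Rats_divide) auto
    show "\<chi> b \<in> F" using b by (intro char_field_incl) simp
  qed
  ultimately show ?thesis by (simp only:)
qed

lemma \<psi>_nontrivial_on_Z:
  assumes "z \<in> Z" "\<psi> z \<noteq> 1" shows "\<psi> g4 \<noteq> 1"
proof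
  assume g4: "\<psi> g4 = 1"
  have "z \<in> generate G {g4}" using assms(1) Z_eq_generate by simp
  then have "z \<in> B \<and> \<psi> z = 1"
  proof (induction rule: generate.induct)
    case (inv h)
    then show ?case using g4 \<psi>_inv[OF gens_in_B(4)] by simp
  qed (simp_all add: \<psi>_one g4 \<psi>_mult)
  with assms(2) show False by simp
qed

text \<open>The stabilizer of the restriction of \<open>\<psi>\<close> to the derived subgroup contains \<open>B\<close>, which is
  maximal, and it does not contain \<open>g\<close>, since \<open>g3\<close> and its conjugate under \<open>g\<close> differ by \<open>g4\<close>.\<close>

lemma conj_not_invariant_on_D:
  assumes "\<psi> g4 \<noteq> 1" "x \<in> carrier G" "x \<notin> B"
  obtains b where "b \<in> D" "\<psi> (x \<otimes> b \<otimes> inv x) \<noteq> \<psi> b"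
proof (rule ccontr)
  assume "\<not> thesis"
  then have x_inv: "\<And>b. b \<in> D \<Longrightarrow> \<psi> (x \<otimes> b \<otimes> inv x) = \<psi> b" using that by blast
  define S where "S = {x \<in> carrier G. \<forall>b\<in>D. \<psi> (x \<otimes> b \<otimes> inv x) = \<psi> b}"
  have "subgroup S G"
  proof
    show "S \<subseteq> carrier G" by (auto simp: S_def)
    show "\<one> \<in> S" using D_carrier by (simp add: S_def)
    fix x assume x: "x \<in> S"
    then have xG: "x \<in> carrier G" and xb: "\<And>b. b \<in> D \<Longrightarrow> \<psi> (x \<otimes> b \<otimes> inv x) = \<psi> b"
      by (auto simp: S_def)
    have "\<psi> (inv x \<otimes> b \<otimes> inv (inv x)) = \<psi> b" if b: "b \<in> D" for b
    proof -
      have "inv x \<otimes> b \<otimes> inv (inv x) \<in> D" using b xG by (intro conj_in_D) auto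
      from xb[OF this] show ?thesis
        using xG D_carrier[OF b] by (simp add: m_assoc mult_inv_cancel)
    qed
    then show "inv x \<in> S" using xG by (simp add: S_def)
    fix y assume y: "y \<in> S"
    then have yG: "y \<in> carrier G" and yb: "\<And>b. b \<in> D \<Longrightarrow> \<psi> (y \<otimes> b \<otimes> inv y) = \<psi> b"
      by (auto simp: S_def)
    have "\<psi> (x \<otimes> y \<otimes> b \<otimes> inv (x \<otimes> y)) = \<psi> b" if b: "b \<in> D" for b
      using xb[OF conj_in_D[OF b yG]] yb[OF b] xG yG D_carrier[OF b]
      by (simp add: m_assoc inv_mult_group)
    then show "x \<otimes> y \<in> S" using xG yG by (simp add: S_def)
  qed
  moreover have "x \<in> S" if "x \<in> B" for x
    using that conj_trivial[OF subsetD[OF D_subset_B]] by (simp add: S_def)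
  then have "B \<subseteq> S" by blast
  moreover have "x \<in> S" using assms(2) x_inv by (simp add: S_def)
  ultimately have "S = carrier G" using B_maximal[of S] assms(3) by blast
  then have "inv g \<in> S" by simp
  then have "\<psi> (inv g \<otimes> g3 \<otimes> g) = \<psi> g3" using g_in_D by (simp add: S_def)
  moreover have "inv g \<otimes> g3 \<otimes> g = g3 \<otimes> g4"
    by (simp add: conj_eq_mult_commutator commutators)
  ultimately have "\<psi> g3 * \<psi> g4 = \<psi> g3" by (simp add: \<psi>_mult)
  then show False using assms(1) \<psi>_nonzero[of g3] by simp
qed

text \<open>Orthogonality of the distinct conjugates of \<open>\<psi>\<close> on the derived subgroup isolates \<open>\<psi> a\<close>.\<close>

lemma sum_\<chi>_D:
  assumes "\<psi> g4 \<noteq> 1" and a: "a \<in> B"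
  shows "(\<Sum>b\<in>D. \<chi> (a \<otimes> b) * \<psi> (inv b)) = of_nat (card D) * \<psi> a"
proof -
  have D: "subgroup D G" using D_normal by (rule normal_imp_subgroup)
  have bB: "b \<in> B" "b \<in> carrier G" if "b \<in> D" for b using that D_subset_B by auto
  define \<mu> where "\<mu> x b = \<psi> (x \<otimes> b \<otimes> inv x) * \<psi> (inv b)" for x b
  have \<mu>_sum: "(\<Sum>b\<in>D. \<mu> x b) = (if x \<in> B then of_nat (card D) else 0)" if x: "x \<in> carrier G" for x
  proof (cases "x \<in> B")
    case True
    have "\<mu> x b = 1" if "b \<in> D" for b
      using that True bB by (simp add: \<mu>_def conj_trivial \<psi>_inv)
    then show ?thesis using True by simp
  next
    case False
    obtain b where b: "b \<in> D" "\<psi> (x \<otimes> b \<otimes> inv x) \<noteq> \<psi> b"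
      using conj_not_invariant_on_D[OF assms(1) x False] by blast
    have "(\<Sum>b\<in>D. \<mu> x b) = 0"
    proof (rule sum_character_eq_0[OF D _ b(1)])
      show "\<mu> x b \<noteq> 1"
      proof
        assume "\<mu> x b = 1"
        then have "\<psi> (x \<otimes> b \<otimes> inv x) * (\<psi> b * \<psi> (inv b)) = \<psi> b"
          by (simp add: \<mu>_def mult.left_commute)
        then show False using b \<psi>_inv[OF bB(1)[OF b(1)]] by simp
      qed
      fix c d assume cd: "c \<in> D" "d \<in> D"
      have "x \<otimes> (c \<otimes> d) \<otimes> inv x = (x \<otimes> c \<otimes> inv x) \<otimes> (x \<otimes> d \<otimes> inv x)"
        using x bB cd by (simp add: m_assoc mult_inv_cancel)
      moreover have "inv (c \<otimes> d) = inv d \<otimes> inv c" using bB cd by (simp add: inv_mult_group)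
      ultimately show "\<mu> x (c \<otimes> d) = \<mu> x c * \<mu> x d"
        using x bB cd by (simp add: \<mu>_def \<psi>_mult conj_in_B)
    qed
    then show ?thesis using False by simp
  qed
  have "\<chi> (a \<otimes> b) * \<psi> (inv b) =
      (\<Sum>x\<in>carrier G. \<psi> (x \<otimes> a \<otimes> inv x) * \<mu> x b) / of_nat (card B)" if b: "b \<in> D" for b
  proof -
    have "x \<otimes> (a \<otimes> b) \<otimes> inv x = (x \<otimes> a \<otimes> inv x) \<otimes> (x \<otimes> b \<otimes> inv x)" if "x \<in> carrier G" for x
      using that a bB[OF b] by (simp add: m_assoc mult_inv_cancel)
    then show ?thesis
      using a bB[OF b] by (simp add: \<chi>_on_B \<psi>_mult conj_in_B \<mu>_def sum_distrib_right mult.assoc)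
  qed
  then have "(\<Sum>b\<in>D. \<chi> (a \<otimes> b) * \<psi> (inv b)) =
      (\<Sum>b\<in>D. \<Sum>x\<in>carrier G. \<psi> (x \<otimes> a \<otimes> inv x) * \<mu> x b) / of_nat (card B)"
    by (simp add: sum_divide_distrib)
  also have "(\<Sum>b\<in>D. \<Sum>x\<in>carrier G. \<psi> (x \<otimes> a \<otimes> inv x) * \<mu> x b) =
      (\<Sum>x\<in>carrier G. \<psi> (x \<otimes> a \<otimes> inv x) * (\<Sum>b\<in>D. \<mu> x b))"
    by (subst sum.swap) (simp add: sum_distrib_left)
  also have "\<dots> = (\<Sum>x\<in>carrier G. if x \<in> B then \<psi> a * of_nat (card D) else 0)"
    by (rule sum.cong) (auto simp: \<mu>_sum conj_trivial a)
  also have "\<dots> = (\<Sum>x\<in>B. \<psi> a * of_nat (card D))"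
    using finite_carrier B.subset by (simp add: sum.inter_restrict[symmetric] Int_absorb1)
  finally show ?thesis
    using prime_gt_0_nat[OF p_prime] by (simp add: card_B)
qed

lemma \<psi>_in_F_nontrivial_on_Z:
  assumes "\<psi> g4 \<noteq> 1" and a: "a \<in> B"
  shows "\<psi> a \<in> F"
proof -
  have "x \<otimes> g4 \<otimes> inv x = g4" if x: "x \<in> carrier G" for x
  proof -
    have "x \<otimes> g4 \<otimes> inv x = g4 \<otimes> x \<otimes> inv x" by (simp only: Z_commute[OF g4_in_Z x])
    also have "\<dots> = g4" using x by (simp add: m_assoc)
    finally show ?thesis .
  qed
  then have g4: "\<psi> g4 \<in> F" by (intro \<psi>_in_F_if_invariant[OF gens_in_B(4)]) (simp only:)
  have D_root: "\<psi> b ^ p = 1" if "b \<in> D" for b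
    using \<psi>_pow[of b p] D_pow[OF that] subsetD[OF D_subset_B that] \<psi>_one by simp
  have \<psi>D: "\<psi> b \<in> F" if b: "b \<in> D" for b
  proof -
    obtain k where "\<psi> b = \<psi> g4 ^ k"
      using prime_root_of_unity_power[OF p_prime D_root[OF g_in_D(3)] assms(1) D_root[OF b]] .
    then show ?thesis using char_field_power[OF g4, of k] by (simp only:)
  qed
  have inv_D: "inv b \<in> D" if "b \<in> D" for b
    by (rule subgroup.m_inv_closed[OF normal_imp_subgroup[OF D_normal] that])
  have "(\<Sum>b\<in>D. \<chi> (a \<otimes> b) * \<psi> (inv b)) \<in> F"
  proof (rule char_field_sum)
    fix b assume b: "b \<in> D"
    have "\<chi> (a \<otimes> b) \<in> F" using a D_carrier[OF b] by (intro char_field_incl) simp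
    then show "\<chi> (a \<otimes> b) * \<psi> (inv b) \<in> F" using \<psi>D[OF inv_D[OF b]] by (rule char_field_mult)
  qed
  then have "(\<Sum>b\<in>D. \<chi> (a \<otimes> b) * \<psi> (inv b)) / of_nat (card D) \<in> F"
    by (rule char_field_divide) (rule char_field_Rats, simp)
  moreover have "card D \<noteq> 0"
  proof -
    have "finite D" using finite_carrier D_subset_B B.subset by (meson finite_subset)
    then show ?thesis using g_in_D(1) by auto
  qed
  ultimately show ?thesis unfolding sum_\<chi>_D[OF assms] by simp
qed

lemma \<psi>_in_F_trivial_on_Z:
  assumes "\<And>z. z \<in> Z \<Longrightarrow> \<psi> z = 1" and a: "a \<in> B"
  shows "\<psi> a \<in> F"
proof -
  have root: "\<psi> x ^ p = 1" if "x \<in> B" for x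
    using that assms(1)[OF B_pow_in_Z] \<psi>_pow[of x p] by simp
  have conj: "\<psi> (x \<otimes> b \<otimes> inv x) = \<psi> b * \<psi> (commutator G b (inv x))"
    if "b \<in> D" "x \<in> carrier G" for b x
  proof -
    have "commutator G b (inv x) \<in> D"
      using that D_carrier by (intro commutator_in_derived) auto
    then have "commutator G b (inv x) \<in> B" "b \<in> B" using that D_subset_B by auto
    then show ?thesis using that by (simp add: conj_eq_mult_commutator \<psi>_mult)
  qed
  obtain b where b: "b \<in> D" "\<psi> b \<noteq> 1"
    and comm: "\<And>x. x \<in> carrier G \<Longrightarrow> \<psi> (commutator G b (inv x)) = 1"
  proof (cases "\<exists>b \<in> D \<inter> Z2. \<psi> b \<noteq> 1")
    case True
    then obtain b where b: "b \<in> D" "b \<in> Z2" "\<psi> b \<noteq> 1" by blast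
    have "\<psi> (commutator G b (inv x)) = 1" if "x \<in> carrier G" for x
      using center_modD[OF b(2), of "inv x"] that assms(1) by simp
    then show ?thesis by (rule that[OF b(1,3)])
  next
    case False
    obtain b where b: "b \<in> D" "\<psi> b \<noteq> 1" using \<psi>_D by blast
    have "\<psi> (commutator G b (inv x)) = 1" if x: "x \<in> carrier G" for x
    proof -
      have "b \<in> Z3" using b(1) D_subset_Z3 by blast
      then have "commutator G b (inv x) \<in> Z2" using x by (intro center_modD[of b]) auto
      moreover have "commutator G b (inv x) \<in> D"
        using b(1) D_carrier x by (intro commutator_in_derived) auto
      ultimately show ?thesis using False by blast
    qed
    then show ?thesis by (rule that[OF b])
  qed
  have bB: "b \<in> B" using b D_subset_B by blast
  have "\<psi> b \<in> F"
    using conj[OF b(1)] comm by (intro \<psi>_in_F_if_invariant[OF bB]) simp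
  moreover obtain k where "\<psi> a = \<psi> b ^ k"
    using prime_root_of_unity_power[OF p_prime root[OF bB] b(2) root[OF a]] .
  ultimately show ?thesis using char_field_power[of "\<psi> b" G \<chi> k] by (simp only:)
qed

lemma char_field_eq: "char_field (G\<lparr>carrier := B\<rparr>) \<psi> = F"
proof
  show "char_field (G\<lparr>carrier := B\<rparr>) \<psi> \<subseteq> F"
  proof (rule char_field_least)
    fix x assume "x \<in> carrier (G\<lparr>carrier := B\<rparr>)"
    then have x: "x \<in> B" by simp
    show "\<psi> x \<in> F"
    proof (cases "\<exists>z \<in> Z. \<psi> z \<noteq> 1")
      case True
      then show ?thesis using \<psi>_nontrivial_on_Z \<psi>_in_F_nontrivial_on_Z x by blast
    next
      case False
      then show ?thesis using \<psi>_in_F_trivial_on_Z x by blast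
    qed
  qed
  have \<psi>: "\<psi> y \<in> char_field (G\<lparr>carrier := B\<rparr>) \<psi>" if "y \<in> B" for y
    using that by (intro char_field_incl) simp
  show "F \<subseteq> char_field (G\<lparr>carrier := B\<rparr>) \<psi>"
  proof (rule char_field_least)
    fix x assume "x \<in> carrier G"
    then show "\<chi> x \<in> char_field (G\<lparr>carrier := B\<rparr>) \<psi>"
      unfolding induced_char_def Let_def
      by (simp, intro char_field_divide char_field_sum) (auto simp: \<psi> char_field_Rats)
  qed
qed

end

theorem theorem20:
  fixes G :: "('a, 'b) monoid_scheme" and p :: nat and \<chi> \<psi> :: "'a \<Rightarrow> complex"
  assumes "prime p" and "p \<ge> 5"
    and "Group.group G" and "Coset.order G = p ^ 5" and "in_Phi9 p G"
    and "\<chi> \<in> nonlinear_chars G"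
    and "\<psi> \<in> Irr_over (G\<lparr>carrier := centralizer G (derived_subgroup G)\<rparr>) (derived_subgroup G)"
    and "\<chi> = induced_char G (centralizer G (derived_subgroup G)) \<psi>"
  shows "required_pair G \<chi> (centralizer G (derived_subgroup G)) \<psi>"
proof -
  interpret group G by (rule assms(3))
  obtain g g1 g2 g3 g4 where "phi9_group G p g g1 g2 g3 g4"
    using phi9_group_exists[OF assms(1,2,4,5)] .
  then interpret phi9_group G p g g1 g2 g3 g4 .
  let ?A = "G\<lparr>carrier := B\<rparr>"
  have \<psi>: "\<psi> \<in> Irr_over ?A D" using assms(7) by (simp only: centralizer_D)
  then have irr: "\<psi> \<in> Irr ?A" by (simp add: Irr_over_def)
  have grp: "group ?A" by (rule subgroup_imp_group[OF B_subgroup])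
  have comm: "x \<otimes>\<^bsub>?A\<^esub> y = y \<otimes>\<^bsub>?A\<^esub> x" if "x \<in> carrier ?A" "y \<in> carrier ?A" for x y
    using B_commute that by simp
  note hom = Irr_commuting_is_hom[OF grp irr comm, simplified]
  interpret phi9_character G p g g1 g2 g3 g4 \<psi>
  proof
    show "\<psi> \<one>\<^bsub>G\<^esub> = 1" by (rule hom(1))
    show "\<psi> (x \<otimes>\<^bsub>G\<^esub> y) = \<psi> x * \<psi> y" if "x \<in> B" "y \<in> B" for x y using that by (rule hom(2))
    show "\<exists>d\<in>D. \<psi> d \<noteq> 1"
      using \<psi> D_subset_B hom(1) by (auto simp: Irr_over_def char_kernel_def)
  qed
  have "\<psi> \<in> linear_chars ?A" using irr hom(1) by (simp add: linear_chars_def)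
  then show ?thesis
    using char_field_eq B_subgroup unfolding assms(8) centralizer_D required_pair_def by simp
qed

end
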